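(* Let $\bm\theta\in\bigcup_{m=1}^M\Theta_m$. The stopping time $\tau=\tau_\alpha$ of the proposed policy (described in the context, with threshold $\beta(n,\alpha)$) satisfies $$\mathbb{P}_{\bm\theta}\left[\limsup_{\alpha\to0}\frac{\tau}{|\log\alpha|}\leq\frac1{D^*(\bm\theta)}\right]=1 .$$
   Context: **Model.** $\mathcal U=\{1,\dots,|\mathcal U|\}$ is a finite set of controls. For each $u\in\mathcal U$, observations under control $u$ follow a single-parameter exponential family with natural parameter set $\Psi_u\subset\mathbb R$; $\Omega=\Psi_1\times\dots\times\Psi_{|\mathcal U|}$. For $\bm\theta=(\theta_1,\dots,\theta_{|\mathcal U|})\in\Omega$, an observation under control $u$ has density (w.r.t. a common measure $\mu$) $p(y;\bm\theta,u)=h_u(y)\exp[\theta_uT_u(y)-A_u(\theta_u)]$, where $T_u$ is the statistic and $A_u$ the log-partition function (convex, infinitely differentiable on $\Psi_u$). $b_u(\kappa)=\sup_\theta(\kappa\theta-A_u(\theta))$ is the convex conjugate of $A_u$; the expectation parameter $\kappa=\dot A_u(\theta)$ and $\theta$ are related by $\theta=\dot b_u(\kappa)$ (dots denote derivatives). The KL divergence under control $u$ is $D_u(\bm\theta\|\bm\theta')=A_u(\theta'_u)-A_u(\theta_u)-\dot A_u(\theta_u)(\theta'_u-\theta_u)$. **Hypotheses.** $\mathcal M=\{1,\dots,M\}$; under hypothesis $m$, $\bm\theta\in\Theta_m\subset\Omega$. Let $\|\cdot\|$ be a norm on $\mathbb R^{|\mathcal U|}$ and $\Delta(\bm x,A)=\inf\{\|\bm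 x-\bm\theta'\|:\bm\theta'\in A\}$. Assume: (1) $\Theta_m=\bigcup_{i=1}^{x_m}\Gamma_m^{(i)}$ is a finite disjoint union; (2) each $\Gamma^{(i)}_m$ is convex and open in its own affine hull; (3) $\Gamma^{(i)}_{m_1}\cap\Gamma^{(j)}_{m_2}=\emptyset$ whenever $m_1\ne m_2$, for all $i,j$; (4) for all $m,i$ and all $\bm\theta\in\Gamma_m^{(i)}$, $\Delta(\bm\theta,\Gamma^{(j)}_{m'})>0$ whenever $m'\ne m$ or $j\ne i$. For $\bm\theta\in\bigcup_m\Theta_m$, $g(\bm\theta)=m$ if $\bm\theta\in\Theta_m$. Let $\mathcal P$ be the set of probability distributions on $\mathcal U$ and $$D^*(\bm\theta)=\sup_{\bm q\in\mathcal P}\ \inf_{\bm\theta'\in\bigcup_{m}\Theta_m\setminus\Theta_{g(\bm\theta)}}\ \sum_{u\in\mathcal U}q_uD_u(\bm\theta\|\bm\theta').$$ The supremum is attained; it is assumed that the hypothesis sets are such that the maximizer is unique, denoted $\bm q^*(\bm\theta)$. **Sampling.** At each time $k=1,2,\dots$ a control $U_k$ is selected and an observation $Y_k$ is obtained; given $U_k=u$, $Y_k$ has density $p(\cdot;\bm\theta,u)$, conditionally independently of the past. $\mathcal F_n=\sigma(U_1,Y_1,\dots,U_n,Y_n)$. $\mathbb P_{\bm\theta},\mathbb E_{\bm\theta}$ denote probability and expectation when the parameter vector is $\bm\theta$. A policy consists of controls $U_n$ ($\mathcal F_{n-1}$-measurable), a stopping time $\tau$, and an $\mathcal F_\tau$-measurable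 decision $\hat m\in\mathcal M$. **Proposed policy.** Let $N_u(n)=\sum_{k=1}^n\mathbf 1_{\{U_k=u\}}$, $S_u(n)=\sum_{k=1}^nT_u(Y_k)\mathbf 1_{\{U_k=u\}}$, and $\underline Y^u(n)=(Y_k:U_k=u,k\le n)$, with $p(\underline Y^u(n);\bm\theta,u)=\prod_{k\le n:U_k=u}p(Y_k;\bm\theta,u)$. Put $$Z_{i,j}(n)=\log\frac{\sup_{\bm\theta'\in\Theta_i}\prod_{u}p(\underline Y^u(n);\bm\theta',u)}{\sup_{\bm\theta''\in\Theta_j}\prod_{u}p(\underline Y^u(n);\bm\theta'',u)},\quad Z_i(n)=\min_{j\ne i}Z_{i,j}(n),\quad Z(n)=\max_{i\in\mathcal M}Z_i(n).$$ Global MLE: $\bm\theta^*(n)=\arg\max_{\bm\theta'\in\Omega}\prod_up(\underline Y^u(n);\bm\theta',u)$, i.e. $\theta^*_u(n)=\dot b_u(S_u(n)/N_u(n))$. *Recommendation:* $\hat r(n)\in\arg\min_{m\in\mathcal M}\Delta(\bm\theta^*(n),\Theta_m)$. *Plug-in estimate:* $\hat{\bm\theta}(n)\in\arg\min_{\bm\theta'\in\Theta_{\hat r(n)}}\|\bm\theta'-\bm\theta^*(n)\|$; if no minimizer exists, $\hat{\bm\theta}(n)\in\Theta_{\hat r(n)}$ is chosen with $\|\hat{\bm\theta}(n)-\bm\theta^*(n)\|\le\rho\,\Delta(\bm\theta^*(n),\Theta_{\hat r(n)})$, where $\rho>1$ is fixed. *Control law:* first, every control is selected once. Afterwards $U_{n+1}\in\arg\max_{u\in\mathcal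 U}\sum_{k=1}^nq_u^{\epsilon_k}(\hat{\bm\theta}(k))-N_u(n)$, where $\epsilon_k=\frac12(|\mathcal U|^2+k)^{-1/2}$ and $\bm q^\epsilon(\bm\theta)$ is an $L^\infty$ projection of $\bm q^*(\bm\theta)$ onto $\{\bm q\in\mathcal P:q_u\in[\epsilon,1]\ \forall u\}$ (for $k<|\mathcal U|$, where the MLE is not yet defined, $\hat{\bm\theta}(k)$ is an arbitrary fixed element of $\bigcup_m\Theta_m$). The control law does not depend on $\alpha$. *Stopping rule:* $\tau=\inf\{n\in\mathbb N:Z(n)\ge\beta(n,\alpha)\}$, with $\beta(n,\alpha)=v(n)+w(\alpha)$, $w(\alpha)=|\log\alpha|+\sqrt{4|\mathcal U||\log\alpha|}$, $$v(n)=C+\log\big(n(1+\log n)^{|\mathcal U|+2}\big)+\sqrt{4|\mathcal U|\log\big(n(1+\log n)^{|\mathcal U|+2}\big)},$$ $$C=2|\mathcal U|\sqrt{2\log\frac{2|\mathcal U|}{e}+\frac1{|\mathcal U|}\log\frac{2e^{|\mathcal U|+1}}{|\mathcal U|^{|\mathcal U|}}}+\log\frac{2e^{|\mathcal U|+1}}{|\mathcal U|^{|\mathcal U|}}.$$ *Decision:* $\hat m\in\arg\max_{m\in\mathcal M}Z_m(\tau)$. *)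

theory Defs
  imports "HOL-Probability.Probability"
begin

definition is_norm :: "('a::real_vector \<Rightarrow> real) \<Rightarrow> bool" where
  "is_norm nrm \<longleftrightarrow>
     (\<forall>x. 0 \<le> nrm x) \<and> (\<forall>x. nrm x = 0 \<longleftrightarrow> x = 0) \<and>
     (\<forall>c x. nrm (c *\<^sub>R x) = \<bar>c\<bar> * nrm x) \<and> (\<forall>x y. nrm (x + y) \<le> nrm x + nrm y)"

definition prob_simplex :: "(real ^ 'u::finite) set" where
  "prob_simplex = {q. (\<forall>u. 0 \<le> q $ u) \<and> (\<Sum>u\<in>UNIV. q $ u) = 1}"

definition is_simplex_projection :: "real \<Rightarrow> real ^ 'u::finite \<Rightarrow> real ^ 'u \<Rightarrow> bool" where
  "is_simplex_projection e q q' \<longleftrightarrow>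
     is_arg_min (\<lambda>r. infnorm (r - q)) (\<lambda>r. r \<in> prob_simplex \<and> (\<forall>u. r $ u \<in> {e..1})) q'"

text \<open>In the following, \<open>d\<close> is the number of controls.\<close>

definition exploration_rate :: "nat \<Rightarrow> nat \<Rightarrow> real" where
  "exploration_rate d k = 1 / 2 * (real d ^ 2 + real k) powr (- 1 / 2)"

definition threshold_const :: "nat \<Rightarrow> real" where
  "threshold_const d =
     (let c = ln (2 * exp (real d + 1) / real d ^ d)
      in 2 * real d * sqrt (2 * ln (2 * real d / exp 1) + 1 / real d * c) + c)"

definition threshold_v :: "nat \<Rightarrow> nat \<Rightarrow> real" where
  "threshold_v d n =
     (let l = ln (real n * (1 + ln (real n)) ^ (d + 2))
      in threshold_const d + l + sqrt (4 * real d * l))"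

definition threshold_w :: "nat \<Rightarrow> real \<Rightarrow> real" where
  "threshold_w d \<alpha> = \<bar>ln \<alpha>\<bar> + sqrt (4 * real d * \<bar>ln \<alpha>\<bar>)"

definition threshold :: "nat \<Rightarrow> nat \<Rightarrow> real \<Rightarrow> real" where
  "threshold d n \<alpha> = threshold_v d n + threshold_w d \<alpha>"

text \<open>
  The finite set of controls is the type \<open>'u\<close>. Only the values of \<open>A u\<close> on the natural
  parameter set are tied to the model. If that set contains one of its endpoints,
  \<open>A u\<close> stands for a smooth extension beyond it, so that the two-sided derivative \<open>deriv\<close>
  there is the one-sided derivative of the log-partition function.
\<close>

locale controlled_family =
  fixes \<mu> :: "'y measure"
    and h :: "'u::finite \<Rightarrow> 'y \<Rightarrow> real"
    and T :: "'u \<Rightarrow> 'y \<Rightarrow> real"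
    and A :: "'u \<Rightarrow> real \<Rightarrow> real"
    and nrm :: "real ^ 'u \<Rightarrow> real"
    and M :: nat
    and x :: "nat \<Rightarrow> nat"
    and \<Gamma> :: "nat \<Rightarrow> nat \<Rightarrow> (real ^ 'u) set"
begin

definition natural_set :: "'u \<Rightarrow> real set" where
  "natural_set u = {t. integrable \<mu> (\<lambda>y. h u y * exp (t * T u y))}"

definition Omega :: "(real ^ 'u) set" where
  "Omega = {\<theta>. \<forall>u. \<theta> $ u \<in> natural_set u}"

definition dens :: "real ^ 'u \<Rightarrow> 'u \<Rightarrow> 'y \<Rightarrow> real" where
  "dens \<theta> u y = h u y * exp (\<theta> $ u * T u y - A u (\<theta> $ u))"

text \<open>Where the supremum is infinite, the value of \<open>conj_b\<close> is meaningless.\<close>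

definition conj_b :: "'u \<Rightarrow> real \<Rightarrow> real" where
  "conj_b u \<kappa> = (SUP t\<in>natural_set u. \<kappa> * t - A u t)"

definition KL :: "'u \<Rightarrow> real ^ 'u \<Rightarrow> real ^ 'u \<Rightarrow> real" where
  "KL u \<theta> \<theta>' = A u (\<theta>' $ u) - A u (\<theta> $ u) - deriv (A u) (\<theta> $ u) * (\<theta>' $ u - \<theta> $ u)"

definition Theta :: "nat \<Rightarrow> (real ^ 'u) set" where
  "Theta m = (\<Union>i\<in>{1..x m}. \<Gamma> m i)"

definition all_Theta :: "(real ^ 'u) set" where
  "all_Theta = (\<Union>m\<in>{1..M}. Theta m)"

definition set_dist :: "real ^ 'u \<Rightarrow> (real ^ 'u) set \<Rightarrow> real" where
  "set_dist \<theta> S = (INF \<theta>'\<in>S. nrm (\<theta> - \<theta>'))"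

definition true_hyp :: "real ^ 'u \<Rightarrow> nat" where
  "true_hyp \<theta> = (THE m. m \<in> {1..M} \<and> \<theta> \<in> Theta m)"

definition info :: "real ^ 'u \<Rightarrow> real ^ 'u \<Rightarrow> ereal" where
  "info \<theta> q = (INF \<theta>'\<in>all_Theta - Theta (true_hyp \<theta>). ereal (\<Sum>u\<in>UNIV. q $ u * KL u \<theta> \<theta>'))"

definition Dstar :: "real ^ 'u \<Rightarrow> ereal" where
  "Dstar \<theta> = (SUP q\<in>prob_simplex. info \<theta> q)"

definition qstar :: "real ^ 'u \<Rightarrow> real ^ 'u" where
  "qstar \<theta> = (THE q. q \<in> prob_simplex \<and> info \<theta> q = Dstar \<theta>)"

end

locale controlled_testing = controlled_family +
  assumes h_measurable: "\<And>u. h u \<in> borel_measurable \<mu>"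
    and T_measurable: "\<And>u. T u \<in> borel_measurable \<mu>"
    and h_nonneg: "\<And>u y. y \<in> space \<mu> \<Longrightarrow> 0 \<le> h u y"
    and log_partition:
      "\<And>u t. t \<in> natural_set u \<Longrightarrow> (\<integral>y. h u y * exp (t * T u y) \<partial>\<mu>) = exp (A u t)"
    and A_convex: "\<And>u. convex_on (natural_set u) (A u)"
    and A_smooth: "\<And>u k t. t \<in> natural_set u \<Longrightarrow> (deriv ^^ k) (A u) differentiable (at t)"
    and natural_of_expectation:
      "\<And>u t. t \<in> natural_set u \<Longrightarrow> (conj_b u has_real_derivative t) (at (deriv (A u) t))"
    and nrm: "is_norm nrm"
    and x_pos: "\<And>m. m \<in> {1..M} \<Longrightarrow> 1 \<le> x m"
    and \<Gamma>_nonempty: "\<And>m i. m \<in> {1..M} \<Longrightarrow> i \<in> {1..x m} \<Longrightarrow> \<Gamma> m i \<noteq> {}"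
    and \<Gamma>_Omega: "\<And>m i. m \<in> {1..M} \<Longrightarrow> i \<in> {1..x m} \<Longrightarrow> \<Gamma> m i \<subseteq> Omega"
    and \<Gamma>_disjoint: "\<And>m. m \<in> {1..M} \<Longrightarrow> disjoint_family_on (\<Gamma> m) {1..x m}"
    and \<Gamma>_convex: "\<And>m i. m \<in> {1..M} \<Longrightarrow> i \<in> {1..x m} \<Longrightarrow> convex (\<Gamma> m i)"
    and \<Gamma>_open: "\<And>m i. m \<in> {1..M} \<Longrightarrow> i \<in> {1..x m} \<Longrightarrow>
                    openin (top_of_set (affine hull (\<Gamma> m i))) (\<Gamma> m i)"
    and \<Gamma>_separate: "\<And>m m' i j. m \<in> {1..M} \<Longrightarrow> m' \<in> {1..M} \<Longrightarrow> m \<noteq> m' \<Longrightarrow>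
                        i \<in> {1..x m} \<Longrightarrow> j \<in> {1..x m'} \<Longrightarrow> \<Gamma> m i \<inter> \<Gamma> m' j = {}"
    and \<Gamma>_dist: "\<And>m m' i j \<theta>. m \<in> {1..M} \<Longrightarrow> m' \<in> {1..M} \<Longrightarrow>
                   i \<in> {1..x m} \<Longrightarrow> j \<in> {1..x m'} \<Longrightarrow> m' \<noteq> m \<or> j \<noteq> i \<Longrightarrow>
                   \<theta> \<in> \<Gamma> m i \<Longrightarrow> 0 < set_dist \<theta> (\<Gamma> m' j)"
    and unique_maximizer:
      "\<And>\<theta>. \<theta> \<in> all_Theta \<Longrightarrow> \<exists>!q. q \<in> prob_simplex \<and> info \<theta> q = Dstar \<theta>"

text \<open>\<open>U n\<close> and \<open>Y n\<close> are indexed by the time \<open>n \<ge> 1\<close>; the values at \<open>n = 0\<close> are not used.\<close>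

locale controlled_process = controlled_family \<mu> h T A nrm M x \<Gamma>
  for \<mu> :: "'y measure"
    and h T :: "'u::finite \<Rightarrow> 'y \<Rightarrow> real"
    and A :: "'u \<Rightarrow> real \<Rightarrow> real"
    and nrm :: "real ^ 'u \<Rightarrow> real"
    and M :: nat
    and x :: "nat \<Rightarrow> nat"
    and \<Gamma> :: "nat \<Rightarrow> nat \<Rightarrow> (real ^ 'u) set" +
  fixes P :: "'w measure"
    and U :: "nat \<Rightarrow> 'w \<Rightarrow> 'u"
    and Y :: "nat \<Rightarrow> 'w \<Rightarrow> 'y"
begin

definition past :: "nat \<Rightarrow> 'w measure" where
  "past n = vimage_algebra (space P) (\<lambda>\<omega>. \<lambda>k\<in>{1..n}. (U k \<omega>, Y k \<omega>))
              (\<Pi>\<^sub>M k\<in>{1..n}. count_space UNIV \<Otimes>\<^sub>M \<mu>)"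

definition num_used :: "'u \<Rightarrow> nat \<Rightarrow> 'w \<Rightarrow> nat" where
  "num_used u n \<omega> = card {k\<in>{1..n}. U k \<omega> = u}"

definition likelihood :: "nat \<Rightarrow> 'w \<Rightarrow> real ^ 'u \<Rightarrow> real" where
  "likelihood n \<omega> \<theta>' = (\<Prod>u\<in>UNIV. \<Prod>k\<in>{k\<in>{1..n}. U k \<omega> = u}. dens \<theta>' u (Y k \<omega>))"

definition Zpair :: "nat \<Rightarrow> nat \<Rightarrow> nat \<Rightarrow> 'w \<Rightarrow> real" where
  "Zpair i j n \<omega> = ln ((SUP \<theta>'\<in>Theta i. likelihood n \<omega> \<theta>') / (SUP \<theta>'\<in>Theta j. likelihood n \<omega> \<theta>'))"

text \<open>Extended reals are used for the convention that a minimum over no alternatives is \<open>\<infinity>\<close>.\<close>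

definition Zhyp :: "nat \<Rightarrow> nat \<Rightarrow> 'w \<Rightarrow> ereal" where
  "Zhyp i n \<omega> = (INF j\<in>{1..M} - {i}. ereal (Zpair i j n \<omega>))"

definition Zmax :: "nat \<Rightarrow> 'w \<Rightarrow> ereal" where
  "Zmax n \<omega> = (SUP i\<in>{1..M}. Zhyp i n \<omega>)"

text \<open>The infimum of the empty set in \<^typ>\<open>enat\<close> is \<open>\<infinity>\<close>.\<close>

definition stop_time :: "real \<Rightarrow> 'w \<Rightarrow> enat" where
  "stop_time \<alpha> \<omega> = Inf (enat ` {n. 1 \<le> n \<and> ereal (threshold CARD('u) n \<alpha>) \<le> Zmax n \<omega>})"

end

text \<open>
  Since \<open>U (Suc n)\<close> is measurable with respect to \<open>past n\<close>, conditioning on \<open>past n\<close> is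
  conditioning on the past and the current control.
\<close>

locale controlled_sampling =
  controlled_process \<mu> h T A nrm M x \<Gamma> P U Y +
  controlled_testing \<mu> h T A nrm M x \<Gamma> +
  prob_space P
  for \<mu> :: "'y measure"
    and h T :: "'u::finite \<Rightarrow> 'y \<Rightarrow> real"
    and A :: "'u \<Rightarrow> real \<Rightarrow> real"
    and nrm :: "real ^ 'u \<Rightarrow> real"
    and M :: nat
    and x :: "nat \<Rightarrow> nat"
    and \<Gamma> :: "nat \<Rightarrow> nat \<Rightarrow> (real ^ 'u) set"
    and P :: "'w measure"
    and U :: "nat \<Rightarrow> 'w \<Rightarrow> 'u"
    and Y :: "nat \<Rightarrow> 'w \<Rightarrow> 'y" +
  fixes \<theta> :: "real ^ 'u"
  assumes Y_measurable: "\<And>n. 1 \<le> n \<Longrightarrow> Y n \<in> measurable P \<mu>"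
    and U_predictable: "\<And>n. U (Suc n) \<in> measurable (past n) (count_space UNIV)"
    and Y_law: "\<And>n B. B \<in> sets \<mu> \<Longrightarrow>
      AE \<omega> in P. real_cond_exp P (past n) (\<lambda>\<omega>'. indicat_real B (Y (Suc n) \<omega>')) \<omega> =
                 (\<integral>y. indicat_real B y * dens \<theta> (U (Suc n) \<omega>) y \<partial>\<mu>)"

text \<open>
  The maximum likelihood estimate may fail to exist at some times (e.g. for Bernoulli observations
  that are all equal); there \<open>mle\<close> is unconstrained. Likewise, if
  \<open>set_dist (mle n \<omega>) (Theta (rec n \<omega>)) = 0\<close> is not attained, no point of the hypothesis set is
  within \<open>\<rho>\<close> times this distance, and \<open>plug_in n \<omega>\<close> is only required to lie in that set.
\<close>

locale proposed_policy =
  controlled_sampling \<mu> h T A nrm M x \<Gamma> P U Y \<theta>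
  for \<mu> :: "'y measure"
    and h T :: "'u::finite \<Rightarrow> 'y \<Rightarrow> real"
    and A :: "'u \<Rightarrow> real \<Rightarrow> real"
    and nrm :: "real ^ 'u \<Rightarrow> real"
    and M :: nat
    and x :: "nat \<Rightarrow> nat"
    and \<Gamma> :: "nat \<Rightarrow> nat \<Rightarrow> (real ^ 'u) set"
    and P :: "'w measure"
    and U :: "nat \<Rightarrow> 'w \<Rightarrow> 'u"
    and Y :: "nat \<Rightarrow> 'w \<Rightarrow> 'y"
    and \<theta> :: "real ^ 'u" +
  fixes \<rho> :: real
    and qproj :: "real \<Rightarrow> real ^ 'u \<Rightarrow> real ^ 'u"
    and \<theta>\<^sub>0 :: "real ^ 'u"
    and mle :: "nat \<Rightarrow> 'w \<Rightarrow> real ^ 'u"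
    and rec :: "nat \<Rightarrow> 'w \<Rightarrow> nat"
    and plug_in :: "nat \<Rightarrow> 'w \<Rightarrow> real ^ 'u"
  assumes \<rho>_gt_1: "1 < \<rho>"
    and qproj: "\<And>e \<theta>'. 0 < e \<Longrightarrow> e \<le> 1 / real CARD('u) \<Longrightarrow> \<theta>' \<in> all_Theta \<Longrightarrow>
                  is_simplex_projection e (qstar \<theta>') (qproj e \<theta>')"
    and \<theta>\<^sub>0: "\<theta>\<^sub>0 \<in> all_Theta"
    and mle: "\<And>n \<omega>. CARD('u) \<le> n \<Longrightarrow> \<omega> \<in> space P \<Longrightarrow>
                \<exists>t. is_arg_max (likelihood n \<omega>) (\<lambda>t. t \<in> Omega) t \<Longrightarrow>
                is_arg_max (likelihood n \<omega>) (\<lambda>t. t \<in> Omega) (mle n \<omega>)"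
    and rec: "\<And>n \<omega>. CARD('u) \<le> n \<Longrightarrow> \<omega> \<in> space P \<Longrightarrow>
                is_arg_min (\<lambda>m. set_dist (mle n \<omega>) (Theta m)) (\<lambda>m. m \<in> {1..M}) (rec n \<omega>)"
    and plug_in_initial: "\<And>n \<omega>. n < CARD('u) \<Longrightarrow> \<omega> \<in> space P \<Longrightarrow> plug_in n \<omega> = \<theta>\<^sub>0"
    and plug_in_mem: "\<And>n \<omega>. CARD('u) \<le> n \<Longrightarrow> \<omega> \<in> space P \<Longrightarrow> plug_in n \<omega> \<in> Theta (rec n \<omega>)"
    and plug_in_minimizer: "\<And>n \<omega>. CARD('u) \<le> n \<Longrightarrow> \<omega> \<in> space P \<Longrightarrow>
      \<exists>t. is_arg_min (\<lambda>t. nrm (t - mle n \<omega>)) (\<lambda>t. t \<in> Theta (rec n \<omega>)) t \<Longrightarrow>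
      is_arg_min (\<lambda>t. nrm (t - mle n \<omega>)) (\<lambda>t. t \<in> Theta (rec n \<omega>)) (plug_in n \<omega>)"
    and plug_in_no_minimizer: "\<And>n \<omega>. CARD('u) \<le> n \<Longrightarrow> \<omega> \<in> space P \<Longrightarrow>
      \<nexists>t. is_arg_min (\<lambda>t. nrm (t - mle n \<omega>)) (\<lambda>t. t \<in> Theta (rec n \<omega>)) t \<Longrightarrow>
      0 < set_dist (mle n \<omega>) (Theta (rec n \<omega>)) \<Longrightarrow>
      nrm (plug_in n \<omega> - mle n \<omega>) \<le> \<rho> * set_dist (mle n \<omega>) (Theta (rec n \<omega>))"
    and initial_controls: "\<And>\<omega>. \<omega> \<in> space P \<Longrightarrow> bij_betw (\<lambda>k. U k \<omega>) {1..CARD('u)} UNIV"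
    and control_law: "\<And>n \<omega>. CARD('u) \<le> n \<Longrightarrow> \<omega> \<in> space P \<Longrightarrow>
      is_arg_max (\<lambda>u. (\<Sum>k\<in>{1..n}. qproj (exploration_rate CARD('u) k) (plug_in k \<omega>) $ u)
                       - real (num_used u n \<omega>))
        (\<lambda>_. True) (U (Suc n) \<omega>)"

end

theory Submission
  imports Defs "HOL-Real_Asymp.Real_Asymp"
begin

text \<open>
  The main probabilistic input is a Chernoff bound. For a natural parameter \<open>t\<close> of control \<open>u\<close>, the
  likelihood ratio of \<open>t\<close> against \<open>\<theta>\<close> on the observations under \<open>u\<close> has mean one, and forced
  exploration gives a deterministic bound \<open>N\<^sub>u(n) \<ge> c \<surd>n\<close>; so Markov's inequality and Borel-Cantelli
  show that the log-likelihood ratio is almost surely eventually at most \<open>\<delta> N\<^sub>u(n)\<close>. Letting \<open>t\<close>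
  tend to \<open>\<theta>\<^sub>u\<close> from either side gives a law of large numbers for \<open>S\<^sub>u(n) / N\<^sub>u(n)\<close>, one-sided if
  \<open>\<theta>\<^sub>u\<close> is an endpoint of the natural parameter set, which suffices because the log-likelihood is
  concave.

  By strict convexity the divergence grows at least linearly in the second argument. Hence the maximum
  likelihood estimate exists eventually and is consistent, the plug-in estimate lies eventually in the
  true hypothesis and converges to \<open>\<theta>\<close>, and, by uniqueness of the maximizer and compactness of the
  simplex, its optimal weights converge to \<open>q\<^sup>*(\<theta>)\<close>. The tracking rule keeps the control counts within \<open>d\<close> of the accumulated
  weights, so \<open>N\<^sub>u(n) / n\<close> is asymptotically at least \<open>q\<^sup>*\<^sub>u(\<theta>)\<close>. Therefore \<open>Z(n) \<ge> c n\<close> eventually for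
  every \<open>c < D\<^sup>*(\<theta>)\<close>, while the threshold is \<open>|ln \<alpha>|\<close> up to lower order terms.
\<close>

section \<open>Divergence of an exponential family\<close>

context controlled_family
begin

text \<open>The Bregman divergence of \<open>A u\<close> with base point \<open>s\<close>; treating
  one coordinate at a time allows convexity arguments along segments of
  \<open>natural_set u\<close>.\<close>

definition bregman :: "'u \<Rightarrow> real \<Rightarrow> real \<Rightarrow> real" where
  "bregman u s t = A u t - A u s - deriv (A u) s * (t - s)"

lemma KL_eq_bregman: "KL u \<theta> \<theta>' = bregman u (\<theta> $ u) (\<theta>' $ u)"
  by (simp add: KL_def bregman_def)

end

context controlled_testing
begin

lemma A_has_derivative:
  "t \<in> natural_set u \<Longrightarrow> (A u has_real_derivative deriv (A u) t) (at t)"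
  using A_smooth[of t u 0] by (simp add: DERIV_deriv_iff_real_differentiable)

lemma isCont_A: "t \<in> natural_set u \<Longrightarrow> isCont (A u) t"
  using A_has_derivative DERIV_isCont by blast

lemma isCont_deriv_A: "t \<in> natural_set u \<Longrightarrow> isCont (deriv (A u)) t"
  using A_smooth[of t u 1] by (simp add: differentiable_imp_continuous_within)

lemma convex_natural_set: "convex (natural_set u)"
  using A_convex[of u] by (simp add: convex_on_def)

lemma natural_set_segment:
  assumes "s \<in> natural_set u" "t \<in> natural_set u" "0 \<le> l" "l \<le> 1"
  shows "s + l * (t - s) \<in> natural_set u"
  using convexD[OF convex_natural_set assms(1,2), of "1 - l" l] assms(3,4)
  by (simp add: algebra_simps)

text \<open>The subtracted tangent at \<open>s\<close> is affine along the segment, so this is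
  convexity of \<open>A u\<close>.\<close>

lemma bregman_scale:
  assumes "s \<in> natural_set u" "t \<in> natural_set u" "0 \<le> l" "l \<le> 1"
  shows "bregman u s (s + l * (t - s)) \<le> l * bregman u s t"
proof -
  have "A u ((1 - l) *\<^sub>R s + l *\<^sub>R t) \<le> (1 - l) * A u s + l * A u t"
    using convex_onD[OF A_convex[of u], of l s t] assms by simp
  then show ?thesis by (simp add: bregman_def algebra_simps)
qed

text \<open>Differentiability of \<open>A u\<close> at \<open>s\<close>. The derivative is
  two-sided, so \<open>t\<close> may leave the natural parameter set.\<close>

lemma bregman_small:
  assumes "s \<in> natural_set u" "0 < \<eta>"
  shows "\<exists>e>0. \<forall>t. \<bar>t - s\<bar> < e \<longrightarrow> \<bar>bregman u s t\<bar> \<le> \<eta> * \<bar>t - s\<bar>"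
proof -
  have "(A u has_derivative (\<lambda>y. deriv (A u) s * y)) (at s)"
    using A_has_derivative[OF assms(1)] by (simp add: has_field_derivative_def)
  then show ?thesis
    using assms(2) unfolding has_derivative_at_alt bregman_def by (simp add: real_norm_def)
qed

text \<open>By \<open>bregman_scale\<close> a negative value at \<open>t\<close> would remain of the
  order of the distance when moving towards \<open>s\<close>, but near \<open>s\<close> the
  divergence is of smaller order. This also covers endpoints of the natural parameter set.\<close>

lemma bregman_nonneg:
  assumes s: "s \<in> natural_set u" and t: "t \<in> natural_set u"
  shows "0 \<le> bregman u s t"
proof (cases "t = s")
  case False
  have "- bregman u s t \<le> 0 + \<eta>" if \<eta>: "0 < \<eta>" for \<eta>
  proof -
    obtain e where e: "0 < e" "\<And>r. \<bar>r - s\<bar> < e \<Longrightarrow> \<bar>bregman u s r\<bar> \<le> \<eta> / \<bar>t - s\<bar> * \<bar>r - s\<bar>"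
      using bregman_small[OF s divide_pos_pos[OF \<eta>, of "\<bar>t - s\<bar>"]] False by (metis zero_less_abs_iff right_minus_eq)
    \<comment> \<open>Contraction by \<open>l\<close> stays on the segment and, by the factor 2,
      ends strictly within \<open>e\<close> of \<open>s\<close>.\<close>
    define l where "l = min 1 (e / (2 * \<bar>t - s\<bar>))"
    have l: "0 < l" "l \<le> 1" "l * \<bar>t - s\<bar> < e"
      using e(1) False by (auto simp: l_def min_def field_simps)
    have "\<bar>bregman u s (s + l * (t - s))\<bar> \<le> \<eta> / \<bar>t - s\<bar> * \<bar>l * (t - s)\<bar>"
      using e(2)[of "s + l * (t - s)"] l by (simp add: abs_mult)
    also have "\<dots> = l * \<eta>" using l False by (simp add: abs_mult)
    finally have "- (l * \<eta>) \<le> l * bregman u s t"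
      using bregman_scale[OF s t, of l] l by linarith
    then have "l * (- bregman u s t) \<le> l * \<eta>" by simp
    then show ?thesis using l(1) by (simp only: mult_le_cancel_left_pos)
  qed
  then have "- bregman u s t \<le> 0" by (rule field_le_epsilon)
  then show ?thesis by simp
qed (simp add: bregman_def)

text \<open>If the divergence vanished, \<open>A u\<close> would be affine between the two points, so that the
  derivative of \<open>conj_b u\<close> at the common slope would have to be both of them.\<close>

lemma bregman_pos:
  assumes s: "s \<in> natural_set u" and t: "t \<in> natural_set u" and ne: "s \<noteq> t"
  shows "0 < bregman u s t"
proof (rule ccontr)
  assume "\<not> 0 < bregman u s t"
  then have z: "bregman u s t = 0" using bregman_nonneg[OF s t] by simp
  have lin: "bregman u s (s + l * (t - s)) = 0" if "0 \<le> l" "l \<le> 1" for l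
    using bregman_scale[OF s t that] bregman_nonneg[OF s natural_set_segment[OF s t that]] z by simp
  let ?d = "deriv (A u) s - deriv (A u) t"
  have "\<bar>?d\<bar> \<le> 0 + \<eta>" if "0 < \<eta>" for \<eta>
  proof -
    obtain e where e: "0 < e" "\<And>r. \<bar>r - t\<bar> < e \<Longrightarrow> \<bar>bregman u t r\<bar> \<le> \<eta> * \<bar>r - t\<bar>"
      using bregman_small[OF t \<open>0 < \<eta>\<close>] by auto
    define l where "l = min 1 (e / (2 * \<bar>s - t\<bar>))"
    have l: "0 < l" "l \<le> 1" "l * \<bar>s - t\<bar> < e"
      using e(1) ne by (auto simp: l_def min_def field_simps)
    \<comment> \<open>On the segment \<open>A u\<close> is affine with its slope at
      \<open>s\<close>, so the divergence with base \<open>t\<close> is the slope difference times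
      the displacement; differentiability at \<open>t\<close> then makes the slopes agree.\<close>
    have "bregman u t (t + l * (s - t)) = bregman u s (s + (1 - l) * (t - s)) - bregman u s t + ?d * (l * (s - t))"
      by (simp add: bregman_def algebra_simps)
    also have "\<dots> = ?d * (l * (s - t))" using lin[of "1 - l"] l z by simp
    finally have "\<bar>?d\<bar> * \<bar>l * (s - t)\<bar> \<le> \<eta> * \<bar>l * (s - t)\<bar>"
      using e(2)[of "t + l * (s - t)"] l by (simp add: abs_mult)
    moreover have "0 < \<bar>l * (s - t)\<bar>" using l ne by simp
    ultimately show ?thesis by (simp only: mult_le_cancel_right_pos add_0)
  qed
  then have "\<bar>?d\<bar> \<le> 0" by (rule field_le_epsilon)
  then have "deriv (A u) s = deriv (A u) t" by simp
  then show False
    using natural_of_expectation[OF s] natural_of_expectation[OF t] DERIV_unique ne by metis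
qed

text \<open>By convexity the ratio of divergence to distance does not decrease when moving away from
  \<open>s\<close>, so its positive value at distance \<open>e\<close> serves as the rate. The sign
  \<open>\<sigma>\<close> selects the side of \<open>s\<close>.\<close>

lemma bregman_linear_growth:
  assumes s: "s \<in> natural_set u" and e: "0 < e"
  shows "\<exists>c>0. \<forall>t\<in>natural_set u. e \<le> \<bar>t - s\<bar> \<longrightarrow> c * \<bar>t - s\<bar> \<le> bregman u s t"
proof -
  have side: "\<exists>c>0. \<forall>t\<in>natural_set u. e \<le> \<sigma> * (t - s) \<longrightarrow> c * \<bar>t - s\<bar> \<le> bregman u s t"
    if \<sigma>: "\<sigma> = 1 \<or> \<sigma> = - 1" for \<sigma> :: real
  proof (cases "s + \<sigma> * e \<in> natural_set u")
    case True
    have "bregman u s (s + \<sigma> * e) / e * \<bar>t - s\<bar> \<le> bregman u s t"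
      if t: "t \<in> natural_set u" "e \<le> \<sigma> * (t - s)" for t
    proof -
      have ab: "\<bar>t - s\<bar> = \<sigma> * (t - s)" using \<sigma> t e by auto
      have "s + e / (\<sigma> * (t - s)) * (t - s) = s + \<sigma> * e"
        using \<sigma> t e by (auto simp: field_simps)
      then have "bregman u s (s + \<sigma> * e) \<le> e / (\<sigma> * (t - s)) * bregman u s t"
        using bregman_scale[OF s t(1), of "e / (\<sigma> * (t - s))"] t e by simp
      moreover have "0 < \<sigma> * (t - s)" using t e by simp
      ultimately show ?thesis using e unfolding ab by (simp add: field_simps)
    qed
    moreover have "0 < bregman u s (s + \<sigma> * e)" using bregman_pos[OF s True] \<sigma> e by auto
    ultimately show ?thesis using e by (intro exI[of _ "bregman u s (s + \<sigma> * e) / e"]) auto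
  next
    case False
    \<comment> \<open>If the point at distance \<open>e\<close> is missing, no natural parameter
      lies that far out on this side, and any constant works.\<close>
    have "s + \<sigma> * e \<in> natural_set u" if t: "t \<in> natural_set u" "e \<le> \<sigma> * (t - s)" for t
    proof -
      have "s + e / (\<sigma> * (t - s)) * (t - s) = s + \<sigma> * e"
        using \<sigma> t e by (auto simp: field_simps)
      then show ?thesis
        using natural_set_segment[OF s t(1), of "e / (\<sigma> * (t - s))"] t e by simp
    qed
    then show ?thesis using False by (intro exI[of _ 1]) auto
  qed
  obtain c1 c2 where c: "0 < c1" "0 < c2"
    "\<And>t. t \<in> natural_set u \<Longrightarrow> e \<le> t - s \<Longrightarrow> c1 * \<bar>t - s\<bar> \<le> bregman u s t"
    "\<And>t. t \<in> natural_set u \<Longrightarrow> e \<le> s - t \<Longrightarrow> c2 * \<bar>t - s\<bar> \<le> bregman u s t"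
    using side[of 1] side[of "- 1"] by auto
  have "min c1 c2 * \<bar>t - s\<bar> \<le> bregman u s t" if "t \<in> natural_set u" "e \<le> \<bar>t - s\<bar>" for t
  proof (cases "s \<le> t")
    case True
    then have "c1 * \<bar>t - s\<bar> \<le> bregman u s t" using c(3)[OF that(1)] that(2) by simp
    moreover have "min c1 c2 * \<bar>t - s\<bar> \<le> c1 * \<bar>t - s\<bar>" by (intro mult_right_mono) auto
    ultimately show ?thesis by linarith
  next
    case False
    then have "c2 * \<bar>t - s\<bar> \<le> bregman u s t" using c(4)[OF that(1)] that(2) by simp
    moreover have "min c1 c2 * \<bar>t - s\<bar> \<le> c2 * \<bar>t - s\<bar>" by (intro mult_right_mono) auto
    ultimately show ?thesis by linarith
  qed
  then show ?thesis using c by (intro exI[of _ "min c1 c2"]) auto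
qed

text \<open>The constant term covers points within distance 1, linear growth the others. In this
  form errors linear in the distance can be absorbed into the divergence.\<close>

lemma dist_le_bregman:
  assumes s: "s \<in> natural_set u"
  shows "\<exists>C>0. \<forall>t\<in>natural_set u. \<bar>t - s\<bar> \<le> C * (1 + bregman u s t)"
proof -
  obtain c where c: "0 < c" "\<And>t. t \<in> natural_set u \<Longrightarrow> 1 \<le> \<bar>t - s\<bar> \<Longrightarrow> c * \<bar>t - s\<bar> \<le> bregman u s t"
    using bregman_linear_growth[OF s, of 1] by auto
  have "\<bar>t - s\<bar> \<le> (1 + 1 / c) * (1 + bregman u s t)" if t: "t \<in> natural_set u" for t
  proof -
    have "\<bar>t - s\<bar> \<le> 1 \<or> \<bar>t - s\<bar> \<le> bregman u s t / c"
      using c(1) c(2)[OF t] by (simp add: field_simps) linarith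
    moreover have "0 \<le> bregman u s t" by (rule bregman_nonneg[OF s t])
    moreover have "0 \<le> bregman u s t / c" using \<open>0 \<le> bregman u s t\<close> c(1) by simp
    moreover have "(1 + 1 / c) * (1 + bregman u s t) = 1 + bregman u s t + 1 / c + bregman u s t / c"
      by (simp add: algebra_simps)
    moreover have "0 < 1 / c" using c(1) by simp
    ultimately show ?thesis by linarith
  qed
  then show ?thesis using c(1) by (intro exI[of _ "1 + 1 / c"]) (auto simp: add_pos_pos)
qed

end

section \<open>Likelihood ratios of the sampled process\<close>

context controlled_process
begin

definition stat_sum :: "'u \<Rightarrow> nat \<Rightarrow> 'w \<Rightarrow> real" where
  "stat_sum u n \<omega> = (\<Sum>k\<in>{k\<in>{1..n}. U k \<omega> = u}. T u (Y k \<omega>))"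

end

context controlled_testing
begin

section \<open>Densities and exponential tilting\<close>

lemma dens_nonneg: "y \<in> space \<mu> \<Longrightarrow> 0 \<le> dens \<theta> u y"
  by (simp add: dens_def h_nonneg)

lemma dens_measurable [measurable]: "dens \<theta> u \<in> borel_measurable \<mu>"
  unfolding dens_def using h_measurable[of u] T_measurable[of u] by measurable

lemma integrable_dens:
  assumes "\<theta> \<in> Omega"
  shows "integrable \<mu> (dens \<theta> u)"
proof -
  have "integrable \<mu> (\<lambda>y. (h u y * exp (\<theta> $ u * T u y)) * exp (- A u (\<theta> $ u)))"
    using assms by (intro integrable_mult_left) (simp add: Omega_def natural_set_def)
  then show ?thesis by (simp add: dens_def[abs_def] exp_diff exp_minus divide_inverse mult.assoc)
qed

text \<open>Tilting \<open>dens \<theta> u\<close> by the likelihood ratio gives the density with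
  parameter \<open>t\<close>, normalized by \<open>log_partition\<close>.\<close>

lemma nn_integral_tilted:
  assumes "t \<in> natural_set u"
  shows "(\<integral>\<^sup>+y. ennreal (exp ((t - \<theta> $ u) * T u y - (A u t - A u (\<theta> $ u)))) * ennreal (dens \<theta> u y) \<partial>\<mu>) = 1"
proof -
  have "(\<integral>\<^sup>+y. ennreal (exp ((t - \<theta> $ u) * T u y - (A u t - A u (\<theta> $ u)))) * ennreal (dens \<theta> u y) \<partial>\<mu>)
      = (\<integral>\<^sup>+y. ennreal (h u y * exp (t * T u y) * exp (- A u t)) \<partial>\<mu>)"
  proof (rule nn_integral_cong)
    fix y
    have "exp ((t - \<theta> $ u) * T u y - (A u t - A u (\<theta> $ u))) * dens \<theta> u y
        = h u y * exp (t * T u y) * exp (- A u t)"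
      by (simp add: dens_def exp_add[symmetric] algebra_simps flip: exp_diff exp_minus)
    then show "ennreal (exp ((t - \<theta> $ u) * T u y - (A u t - A u (\<theta> $ u)))) * ennreal (dens \<theta> u y)
        = ennreal (h u y * exp (t * T u y) * exp (- A u t))"
      by (metis ennreal_mult'' ennreal_mult' exp_ge_zero)
  qed
  also have "\<dots> = ennreal (\<integral>y. h u y * exp (t * T u y) * exp (- A u t) \<partial>\<mu>)"
    using assms h_nonneg by (intro nn_integral_eq_integral integrable_mult_left) (auto simp: natural_set_def)
  also have "\<dots> = 1"
    using log_partition[OF assms] by (simp add: exp_minus)
  finally show ?thesis .
qed

lemma nn_integral_dens:
  assumes "\<theta> \<in> Omega"
  shows "(\<integral>\<^sup>+y. ennreal (dens \<theta> u y) \<partial>\<mu>) = 1"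
  using nn_integral_tilted[of "\<theta> $ u" u \<theta>] assms by (simp add: Omega_def)

end

context controlled_sampling
begin

section \<open>Measurability of the history and the conditional law of the next observation\<close>

lemma space_past [simp]: "space (past n) = space P"
  by (simp add: past_def)

text \<open>Measurability of the controls is a premise because it is itself derived from this lemma
  by induction over time.\<close>

lemma history_measurable:
  assumes "\<And>k. k \<in> {1..n} \<Longrightarrow> U k \<in> measurable P (count_space UNIV)"
  shows "(\<lambda>\<omega>. \<lambda>k\<in>{1..n}. (U k \<omega>, Y k \<omega>)) \<in> measurable P (\<Pi>\<^sub>M k\<in>{1..n}. count_space UNIV \<Otimes>\<^sub>M \<mu>)"
  using assms Y_measurable by (intro measurable_restrict measurable_Pair) auto

lemma U_measurable: "k \<in> {1..n} \<Longrightarrow> U k \<in> measurable P (count_space UNIV)"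
proof (induction n arbitrary: k)
  case (Suc n)
  have "subalgebra P (past n)"
    unfolding subalgebra_def past_def using history_measurable[OF Suc.IH]
    by (simp add: sets_image_in_sets)
  then have "U (Suc n) \<in> measurable P (count_space UNIV)"
    using U_predictable measurable_from_subalg by blast
  then show ?case using Suc by (cases "k = Suc n") auto
qed simp

lemma history_P:
  "(\<lambda>\<omega>. \<lambda>k\<in>{1..n}. (U k \<omega>, Y k \<omega>)) \<in> measurable P (\<Pi>\<^sub>M k\<in>{1..n}. count_space UNIV \<Otimes>\<^sub>M \<mu>)"
  by (rule history_measurable) (rule U_measurable)

lemma subalgebra_past: "subalgebra P (past n)"
  unfolding subalgebra_def past_def using history_P by (simp add: sets_image_in_sets)

lemma sigma_finite_subalgebra_past: "sigma_finite_subalgebra P (past n)"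
  using subalgebra_past by (intro finite_measure_subalgebra_is_sigma_finite)
    (simp add: finite_measure_subalgebra_def finite_measure_axioms finite_measure_subalgebra_axioms_def)

lemma history_past:
  assumes "k \<in> {1..n}"
  shows "(\<lambda>\<omega>. (U k \<omega>, Y k \<omega>)) \<in> measurable (past n) (count_space UNIV \<Otimes>\<^sub>M \<mu>)"
proof -
  let ?H = "\<lambda>\<omega>. \<lambda>k\<in>{1..n}. (U k \<omega>, Y k \<omega>)"
  have "?H \<in> measurable (past n) (\<Pi>\<^sub>M k\<in>{1..n}. count_space UNIV \<Otimes>\<^sub>M \<mu>)"
    unfolding past_def using measurable_space[OF history_P]
    by (intro measurable_vimage_algebra1) auto
  from measurable_compose[OF this measurable_component_singleton[OF assms]]
  show ?thesis using assms by simp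
qed

lemma U_past: "k \<in> {1..n} \<Longrightarrow> U k \<in> measurable (past n) (count_space UNIV)"
  and Y_past: "k \<in> {1..n} \<Longrightarrow> Y k \<in> measurable (past n) \<mu>"
  using measurable_compose[OF history_past measurable_fst] measurable_compose[OF history_past measurable_snd]
  by auto

text \<open>\<open>Y_law\<close> in integrated form with a nonnegative weight \<open>F\<close>,
  which avoids integrability conditions later.\<close>

lemma nn_integral_next_indicator:
  assumes F [measurable]: "F \<in> borel_measurable (past n)" and B [measurable]: "B \<in> sets \<mu>"
    and \<theta>: "\<theta> \<in> Omega"
  shows "(\<integral>\<^sup>+\<omega>. F \<omega> * indicator B (Y (Suc n) \<omega>) \<partial>P)
    = (\<integral>\<^sup>+\<omega>. F \<omega> * (\<integral>\<^sup>+y. ennreal (dens \<theta> (U (Suc n) \<omega>) y) * indicator B y \<partial>\<mu>) \<partial>P)"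
proof -
  interpret sigma_finite_subalgebra P "past n" by (rule sigma_finite_subalgebra_past)
  have Y' [measurable]: "Y (Suc n) \<in> measurable P \<mu>" by (simp add: Y_measurable)
  let ?I = "\<lambda>\<omega>. indicat_real B (Y (Suc n) \<omega>)"
  have I: "(\<lambda>\<omega>. ennreal (?I \<omega>)) = (\<lambda>\<omega>. indicator B (Y (Suc n) \<omega>))"
    by (auto simp: indicator_def)
  \<comment> \<open>\<open>real_cond_exp\<close> is a difference of two nonnegative conditional
    expectations. It determines the first because that one is at most 1, hence finite, and the
    second vanishes.\<close>
  have le1: "AE \<omega> in P. nn_cond_exp P (past n) (\<lambda>\<omega>. ennreal (?I \<omega>)) \<omega> \<le> nn_cond_exp P (past n) (\<lambda>_. 1) \<omega>"
    by (intro nn_cond_exp_mono) (auto simp: indicator_def)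
  have one: "AE \<omega> in P. (\<lambda>_. 1) \<omega> = nn_cond_exp P (past n) (\<lambda>_. 1) \<omega>"
    by (rule nn_cond_exp_F_meas) simp
  have zero: "AE \<omega> in P. (\<lambda>_. 0) \<omega> = nn_cond_exp P (past n) (\<lambda>_. 0) \<omega>"
    by (rule nn_cond_exp_F_meas) simp
  have neg: "(\<lambda>\<omega>. ennreal (- ?I \<omega>)) = (\<lambda>_. 0)"
    by (auto simp: indicator_def fun_eq_iff ennreal_neg)
  have "AE \<omega> in P. nn_cond_exp P (past n) (\<lambda>\<omega>. ennreal (?I \<omega>)) \<omega>
      = (\<integral>\<^sup>+y. ennreal (dens \<theta> (U (Suc n) \<omega>) y) * indicator B y \<partial>\<mu>)"
    using le1 one zero Y_law[OF B, of n]
  proof eventually_elim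
    case (elim \<omega>)
    let ?N = "nn_cond_exp P (past n) (\<lambda>\<omega>. ennreal (?I \<omega>)) \<omega>"
    have fin: "?N < top" using elim(1,2) by (metis ennreal_one_less_top order_le_less_trans)
    have "?N = ennreal (real_cond_exp P (past n) ?I \<omega>)"
      using fin elim(3) by (simp add: real_cond_exp_def neg)
    also have "\<dots> = ennreal (\<integral>y. indicat_real B y * dens \<theta> (U (Suc n) \<omega>) y \<partial>\<mu>)"
      using elim(4) by simp
    also have "\<dots> = (\<integral>\<^sup>+y. ennreal (indicat_real B y * dens \<theta> (U (Suc n) \<omega>) y) \<partial>\<mu>)"
      using integrable_mult_indicator[OF B integrable_dens[OF \<theta>, of "U (Suc n) \<omega>"]] dens_nonneg
      by (intro nn_integral_eq_integral[symmetric]) auto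
    also have "\<dots> = (\<integral>\<^sup>+y. ennreal (dens \<theta> (U (Suc n) \<omega>) y) * indicator B y \<partial>\<mu>)"
      by (intro nn_integral_cong) (auto simp: indicator_def)
    finally show ?case .
  qed
  then have "(\<integral>\<^sup>+\<omega>. F \<omega> * (\<integral>\<^sup>+y. ennreal (dens \<theta> (U (Suc n) \<omega>) y) * indicator B y \<partial>\<mu>) \<partial>P)
     = (\<integral>\<^sup>+\<omega>. F \<omega> * nn_cond_exp P (past n) (\<lambda>\<omega>. ennreal (?I \<omega>)) \<omega> \<partial>P)"
    by (intro nn_integral_cong_AE) (auto elim!: eventually_mono)
  also have "\<dots> = (\<integral>\<^sup>+\<omega>. F \<omega> * ennreal (?I \<omega>) \<partial>P)"
    by (rule nn_cond_exp_intg) auto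
  finally show ?thesis by (simp add: I[THEN fun_cong])
qed

lemma nn_integral_next:
  assumes F [measurable]: "F \<in> borel_measurable (past n)" and f [measurable]: "f \<in> borel_measurable \<mu>"
    and \<theta>: "\<theta> \<in> Omega"
  shows "(\<integral>\<^sup>+\<omega>. F \<omega> * indicator {v} (U (Suc n) \<omega>) * f (Y (Suc n) \<omega>) \<partial>P)
    = (\<integral>\<^sup>+\<omega>. F \<omega> * indicator {v} (U (Suc n) \<omega>) \<partial>P) * (\<integral>\<^sup>+y. f y * ennreal (dens \<theta> v y) \<partial>\<mu>)"
proof -
  have [measurable]: "Y (Suc n) \<in> measurable P \<mu>" by (simp add: Y_measurable)
  have [measurable]: "U (Suc n) \<in> measurable (past n) (count_space UNIV)" by (rule U_predictable)
  define G where "G \<omega> = F \<omega> * indicator {v} (U (Suc n) \<omega>)" for \<omega>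
  have Gp [measurable]: "G \<in> borel_measurable (past n)" unfolding G_def by measurable
  have GP [measurable]: "G \<in> borel_measurable P" by (rule measurable_from_subalg[OF subalgebra_past Gp])
  define c where "c = (\<integral>\<^sup>+\<omega>. G \<omega> \<partial>P)"
  \<comment> \<open>Equality of two measures carries the identity from indicators to general
    \<open>f\<close>: on the event that \<open>v\<close> is selected, the conditional law of the
    observation is fixed.\<close>
  have "distr (density P G) \<mu> (Y (Suc n)) = density \<mu> (\<lambda>y. c * ennreal (dens \<theta> v y))" (is "?L = ?R")
  proof (rule measure_eqI)
    fix B assume "B \<in> sets ?L"
    then have B [measurable]: "B \<in> sets \<mu>" by simp
    let ?d = "\<lambda>v. \<integral>\<^sup>+y. ennreal (dens \<theta> v y) * indicator B y \<partial>\<mu>"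
    have "emeasure ?L B = (\<integral>\<^sup>+\<omega>. indicator B (Y (Suc n) \<omega>) \<partial>density P G)"
      by (simp add: nn_integral_distr flip: nn_integral_indicator)
    also have "\<dots> = (\<integral>\<^sup>+\<omega>. G \<omega> * indicator B (Y (Suc n) \<omega>) \<partial>P)"
      by (simp add: nn_integral_density)
    also have "\<dots> = (\<integral>\<^sup>+\<omega>. G \<omega> * ?d (U (Suc n) \<omega>) \<partial>P)"
      by (rule nn_integral_next_indicator[OF Gp B \<theta>])
    also have "\<dots> = (\<integral>\<^sup>+\<omega>. G \<omega> * ?d v \<partial>P)"
      by (intro nn_integral_cong) (auto simp: G_def indicator_def)
    also have "\<dots> = c * ?d v"
      by (simp add: nn_integral_multc c_def)
    also have "\<dots> = emeasure ?R B"
      by (simp add: emeasure_density nn_integral_cmult[symmetric] mult.assoc)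
    finally show "emeasure ?L B = emeasure ?R B" .
  qed simp
  then have "(\<integral>\<^sup>+y. f y \<partial>?L) = (\<integral>\<^sup>+y. f y \<partial>?R)" by simp
  then have "(\<integral>\<^sup>+\<omega>. G \<omega> * f (Y (Suc n) \<omega>) \<partial>P) = (\<integral>\<^sup>+y. c * ennreal (dens \<theta> v y) * f y \<partial>\<mu>)"
    by (simp add: nn_integral_distr nn_integral_density)
  also have "\<dots> = c * (\<integral>\<^sup>+y. f y * ennreal (dens \<theta> v y) \<partial>\<mu>)"
    by (simp add: nn_integral_cmult[symmetric] mult_ac)
  finally show ?thesis by (simp add: G_def c_def)
qed

lemma sum_indicator_singleton: "(\<Sum>v\<in>UNIV. indicator {v::'u} w * c v) = (c w :: ennreal)"
proof -
  have "(\<Sum>v\<in>UNIV. indicator {v} w * c v) = (\<Sum>v\<in>UNIV. if w = v then c v else 0)"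
    by (intro sum.cong) (auto simp: indicator_def)
  then show ?thesis by simp
qed

lemma nn_integral_next_sum:
  assumes F [measurable]: "F \<in> borel_measurable (past n)"
    and f [measurable]: "\<And>v. f v \<in> borel_measurable \<mu>" and \<theta>: "\<theta> \<in> Omega"
  shows "(\<integral>\<^sup>+\<omega>. F \<omega> * f (U (Suc n) \<omega>) (Y (Suc n) \<omega>) \<partial>P)
    = (\<Sum>v\<in>UNIV. (\<integral>\<^sup>+\<omega>. F \<omega> * indicator {v} (U (Suc n) \<omega>) \<partial>P) * (\<integral>\<^sup>+y. f v y * ennreal (dens \<theta> v y) \<partial>\<mu>))"
proof -
  have [measurable]: "Y (Suc n) \<in> measurable P \<mu>" by (simp add: Y_measurable)
  have [measurable]: "U (Suc n) \<in> measurable P (count_space UNIV)"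
    by (rule measurable_from_subalg[OF subalgebra_past U_predictable])
  have [measurable]: "F \<in> borel_measurable P" by (rule measurable_from_subalg[OF subalgebra_past F])
  have "(\<integral>\<^sup>+\<omega>. F \<omega> * f (U (Suc n) \<omega>) (Y (Suc n) \<omega>) \<partial>P)
    = (\<integral>\<^sup>+\<omega>. (\<Sum>v\<in>UNIV. F \<omega> * indicator {v} (U (Suc n) \<omega>) * f v (Y (Suc n) \<omega>)) \<partial>P)"
    using sum_indicator_singleton
    by (intro nn_integral_cong) (simp add: mult.assoc flip: sum_distrib_left)
  also have "\<dots> = (\<Sum>v\<in>UNIV. \<integral>\<^sup>+\<omega>. F \<omega> * indicator {v} (U (Suc n) \<omega>) * f v (Y (Suc n) \<omega>) \<partial>P)"
    by (intro nn_integral_sum) measurable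
  finally show ?thesis by (simp add: nn_integral_next[OF F f \<theta>])
qed

text \<open>Supermartingale argument: given the past, each new factor has mean at most 1 whichever
  control is selected.\<close>

lemma nn_integral_prod_le_1:
  assumes \<theta>: "\<theta> \<in> Omega" and g [measurable]: "\<And>v. g v \<in> borel_measurable \<mu>"
    and le: "\<And>v. (\<integral>\<^sup>+y. g v y * ennreal (dens \<theta> v y) \<partial>\<mu>) \<le> 1"
  shows "(\<integral>\<^sup>+\<omega>. (\<Prod>k\<in>{1..n}. g (U k \<omega>) (Y k \<omega>)) \<partial>P) \<le> 1"
proof (induction n)
  case (Suc n)
  let ?F = "\<lambda>\<omega>. \<Prod>k\<in>{1..n}. g (U k \<omega>) (Y k \<omega>)"
  have gm: "(\<lambda>\<omega>. g (U k \<omega>) (Y k \<omega>)) \<in> borel_measurable (past n)" if k: "k \<in> {1..n}" for k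
  proof -
    have [measurable]: "U k \<in> measurable (past n) (count_space UNIV)" by (rule U_past[OF k])
    have [measurable]: "Y k \<in> measurable (past n) \<mu>" by (rule Y_past[OF k])
    show ?thesis by measurable
  qed
  then have F: "?F \<in> borel_measurable (past n)"
    by (intro borel_measurable_prod_ennreal) auto
  have FP [measurable]: "?F \<in> borel_measurable P" by (rule measurable_from_subalg[OF subalgebra_past F])
  have [measurable]: "U (Suc n) \<in> measurable P (count_space UNIV)"
    by (rule measurable_from_subalg[OF subalgebra_past U_predictable])
  have "(\<integral>\<^sup>+\<omega>. (\<Prod>k\<in>{1..Suc n}. g (U k \<omega>) (Y k \<omega>)) \<partial>P) = (\<integral>\<^sup>+\<omega>. ?F \<omega> * g (U (Suc n) \<omega>) (Y (Suc n) \<omega>) \<partial>P)"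
    by (simp add: mult.commute)
  also have "\<dots> = (\<Sum>v\<in>UNIV. (\<integral>\<^sup>+\<omega>. ?F \<omega> * indicator {v} (U (Suc n) \<omega>) \<partial>P)
      * (\<integral>\<^sup>+y. g v y * ennreal (dens \<theta> v y) \<partial>\<mu>))"
    by (rule nn_integral_next_sum[OF F g \<theta>])
  also have "\<dots> \<le> (\<Sum>v\<in>UNIV. (\<integral>\<^sup>+\<omega>. ?F \<omega> * indicator {v} (U (Suc n) \<omega>) \<partial>P) * 1)"
    using le by (intro sum_mono mult_left_mono) auto
  also have "\<dots> = (\<integral>\<^sup>+\<omega>. (\<Sum>v\<in>UNIV. ?F \<omega> * indicator {v} (U (Suc n) \<omega>)) \<partial>P)"
    by (simp only: mult_1_right) (intro nn_integral_sum[symmetric], measurable)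
  also have "\<dots> = (\<integral>\<^sup>+\<omega>. ?F \<omega> \<partial>P)"
    using sum_indicator_singleton[where c="\<lambda>_. 1"]
    by (intro nn_integral_cong) (simp flip: sum_distrib_left)
  finally show ?case using Suc.IH by simp
qed (simp add: emeasure_space_1)

text \<open>Where \<open>h\<close> vanishes the density does too. Excluding such observations makes
  all likelihoods positive, so that logarithms of their ratios are meaningful.\<close>

lemma AE_h_pos:
  assumes \<theta>: "\<theta> \<in> Omega"
  shows "AE \<omega> in P. \<forall>k\<ge>1. 0 < h (U k \<omega>) (Y k \<omega>)"
proof -
  have "AE \<omega> in P. 0 < h (U (Suc n) \<omega>) (Y (Suc n) \<omega>)" for n
  proof -
    have [measurable]: "Y (Suc n) \<in> measurable P \<mu>" by (simp add: Y_measurable)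
    have [measurable]: "U (Suc n) \<in> measurable P (count_space UNIV)"
      by (rule measurable_from_subalg[OF subalgebra_past U_predictable])
    have [measurable]: "h v \<in> borel_measurable \<mu>" for v by (rule h_measurable)
    let ?f = "\<lambda>v y. indicator {..0} (h v y) :: ennreal"
    have "(\<integral>\<^sup>+y. ?f v y * ennreal (dens \<theta> v y) \<partial>\<mu>) = (\<integral>\<^sup>+y. 0 \<partial>\<mu>)" for v
      using h_nonneg by (intro nn_integral_cong) (auto simp: indicator_def dens_def intro: antisym)
    then have "(\<integral>\<^sup>+\<omega>. 1 * ?f (U (Suc n) \<omega>) (Y (Suc n) \<omega>) \<partial>P) = 0"
      by (subst nn_integral_next_sum[OF _ _ \<theta>]) auto
    then have "AE \<omega> in P. ?f (U (Suc n) \<omega>) (Y (Suc n) \<omega>) = 0"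
      by (subst (asm) nn_integral_0_iff_AE) auto
    then show ?thesis
      by eventually_elim (auto simp: indicator_def split: if_splits)
  qed
  then have "AE \<omega> in P. \<forall>n. 0 < h (U (Suc n) \<omega>) (Y (Suc n) \<omega>)" by (simp add: AE_all_countable)
  then show ?thesis
    by eventually_elim (metis One_nat_def Suc_le_D)
qed

text \<open>The count is random, so the deterministic lower bound \<open>a\<close> supplies the
  summable error probabilities. Of the two \<open>\<delta>\<close> in the bound, one is the drift
  subtracted in \<open>X\<close>, the other the level in Markov's inequality.\<close>

lemma AE_log_ratio_bound:
  assumes \<theta>: "\<theta> \<in> Omega" and t: "t \<in> natural_set u" and \<delta>: "0 < \<delta>"
    and a: "\<And>n \<omega>. \<omega> \<in> space P \<Longrightarrow> a n \<le> real (num_used u n \<omega>)"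
    and sum: "summable (\<lambda>n. exp (- \<delta> * a n))"
  shows "AE \<omega> in P. \<forall>\<^sub>F n in sequentially.
    (t - \<theta> $ u) * stat_sum u n \<omega> - real (num_used u n \<omega>) * (A u t - A u (\<theta> $ u)) \<le> 2 * \<delta> * real (num_used u n \<omega>)"
proof -
  have [measurable]: "T u \<in> borel_measurable \<mu>" by (rule T_measurable)
  \<comment> \<open>The log-likelihood ratio of one observation minus \<open>\<delta>\<close>;
    observations under other controls contribute a factor 1 to the product.\<close>
  define X where "X v y = (if v = u then (t - \<theta> $ u) * T u y - (A u t - A u (\<theta> $ u)) - \<delta> else 0)" for v y
  have X_meas [measurable]: "X v \<in> borel_measurable \<mu>" for v
    by (cases "v = u") (simp_all add: X_def[abs_def])
  define W where "W n \<omega> = (\<Sum>k\<in>{1..n}. X (U k \<omega>) (Y k \<omega>))" for n \<omega>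
  have W: "W n \<omega> = (t - \<theta> $ u) * stat_sum u n \<omega> - real (num_used u n \<omega>) * (A u t - A u (\<theta> $ u))
      - \<delta> * real (num_used u n \<omega>)" for n \<omega>
  proof -
    have "W n \<omega> = (\<Sum>k\<in>{k\<in>{1..n}. U k \<omega> = u}. (t - \<theta> $ u) * T u (Y k \<omega>) - (A u t - A u (\<theta> $ u)) - \<delta>)"
      unfolding W_def X_def by (intro sum.inter_filter[symmetric]) simp
    then show ?thesis
      by (simp add: stat_sum_def num_used_def sum_subtractf flip: sum_distrib_left)
  qed
  have bound: "(\<integral>\<^sup>+\<omega>. ennreal (exp (W n \<omega>)) \<partial>P) \<le> 1" for n
  proof -
    have "(\<integral>\<^sup>+y. ennreal (exp (X v y)) * ennreal (dens \<theta> v y) \<partial>\<mu>) \<le> 1" for v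
    proof (cases "v = u")
      case True
      have "(\<integral>\<^sup>+y. ennreal (exp (X v y)) * ennreal (dens \<theta> v y) \<partial>\<mu>)
        \<le> (\<integral>\<^sup>+y. ennreal (exp ((t - \<theta> $ u) * T u y - (A u t - A u (\<theta> $ u)))) * ennreal (dens \<theta> u y) \<partial>\<mu>)"
        unfolding True using \<delta> by (intro nn_integral_mono mult_right_mono ennreal_leI) (auto simp: X_def)
      then show ?thesis using nn_integral_tilted[OF t] by simp
    next
      case False
      then show ?thesis using nn_integral_dens[OF \<theta>] by (simp add: X_def)
    qed
    from nn_integral_prod_le_1[where g="\<lambda>v y. ennreal (exp (X v y))", OF \<theta> _ this]
    have "(\<integral>\<^sup>+\<omega>. (\<Prod>k\<in>{1..n}. ennreal (exp (X (U k \<omega>) (Y k \<omega>)))) \<partial>P) \<le> 1"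
      by simp
    then show ?thesis by (simp add: W_def exp_sum prod_ennreal)
  qed
  have W_meas [measurable]: "W n \<in> borel_measurable P" for n
  proof -
    have "(\<lambda>\<omega>. X (U k \<omega>) (Y k \<omega>)) \<in> borel_measurable P" if "k \<in> {1..n}" for k
    proof -
      have [measurable]: "U k \<in> measurable P (count_space UNIV)" by (rule U_measurable[OF that])
      have [measurable]: "Y k \<in> measurable P \<mu>" using that by (intro Y_measurable) simp
      show ?thesis by measurable
    qed
    then show ?thesis unfolding W_def by (intro borel_measurable_sum) auto
  qed
  define E where "E n = {\<omega>\<in>space P. \<delta> * a n \<le> W n \<omega>}" for n
  have E [measurable]: "E n \<in> sets P" for n unfolding E_def by measurable
  have mE: "measure P (E n) \<le> exp (- \<delta> * a n)" for n
  proof -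
    let ?f = "\<lambda>\<omega>. ennreal (exp (W n \<omega>))" and ?c = "ennreal (exp (- \<delta> * a n))"
    have "E n = {\<omega>\<in>space P. 1 \<le> ?c * ?f \<omega>}"
      by (auto simp: E_def simp flip: ennreal_mult'' exp_add)
    then have "emeasure P (E n) = emeasure P {\<omega>\<in>space P. 1 \<le> ?c * ?f \<omega>}" by simp
    also have "\<dots> \<le> ?c * (\<integral>\<^sup>+\<omega>. ?f \<omega> * indicator (space P) \<omega> \<partial>P)"
      by (rule nn_integral_Markov_inequality) auto
    also have "(\<integral>\<^sup>+\<omega>. ?f \<omega> * indicator (space P) \<omega> \<partial>P) = (\<integral>\<^sup>+\<omega>. ?f \<omega> \<partial>P)"
      by (intro nn_integral_cong) simp
    also have "?c * \<dots> \<le> ?c * 1"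
      by (intro mult_left_mono bound) simp
    finally show ?thesis by (simp add: emeasure_eq_measure)
  qed
  have "AE \<omega> in P. \<forall>\<^sub>F n in sequentially. \<omega> \<in> space P - E n"
    using mE sum by (intro borel_cantelli_AE1 summable_comparison_test'[OF sum]) (auto simp: emeasure_eq_measure)
  then show ?thesis
  proof eventually_elim
    case (elim \<omega>)
    then show ?case
    proof eventually_elim
      case (elim n)
      then have "W n \<omega> < \<delta> * a n" by (auto simp: E_def)
      also have "\<dots> \<le> \<delta> * real (num_used u n \<omega>)" using a[of \<omega> n] elim \<delta> by simp
      finally show ?case unfolding W by simp
    qed
  qed
qed

end

section \<open>Tracking and the law of large numbers\<close>

context controlled_process
begin

lemma num_used_0 [simp]: "num_used u 0 \<omega> = 0"
  by (simp add: num_used_def)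

lemma num_used_Suc: "num_used u (Suc n) \<omega> = num_used u n \<omega> + (if U (Suc n) \<omega> = u then 1 else 0)"
proof -
  have "{k\<in>{1..Suc n}. U k \<omega> = u} = {k\<in>{1..n}. U k \<omega> = u} \<union> (if U (Suc n) \<omega> = u then {Suc n} else {})"
    by (auto simp: le_Suc_eq)
  then show ?thesis by (simp add: num_used_def card_insert_if)
qed

lemma sum_num_used: "(\<Sum>u\<in>UNIV. num_used u n \<omega>) = n"
  by (induction n) (simp_all add: num_used_Suc sum.distrib)

lemma num_used_mono: "m \<le> n \<Longrightarrow> num_used u m \<omega> \<le> num_used u n \<omega>"
  by (rule lift_Suc_mono_le[of "\<lambda>n. num_used u n \<omega>"]) (simp_all add: num_used_Suc)

end

section \<open>Size of the exploration rate\<close>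

lemma exploration_rate_pos: "0 < d \<Longrightarrow> 0 < exploration_rate d k"
  using add_pos_nonneg[of "real d ^ 2" "real k"] by (simp add: exploration_rate_def)

lemma exploration_rate_antimono: "0 < d \<Longrightarrow> j \<le> k \<Longrightarrow> exploration_rate d k \<le> exploration_rate d j"
  unfolding exploration_rate_def
  by (intro mult_left_mono powr_mono2') (simp_all add: add_pos_nonneg)

text \<open>The maximum, at \<open>k = 0\<close>, is half of the uniform weight, so the truncated
  simplex is nonempty at every time.\<close>

lemma exploration_rate_le:
  assumes "0 < d"
  shows "exploration_rate d k \<le> 1 / (2 * real d)"
proof -
  have "(real d ^ 2) powr (- 1 / 2) = (real d powr 2) powr (- 1 / 2)"
    using assms by simp
  also have "\<dots> = real d powr (- 1)" by (simp only: powr_powr) simp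
  also have "\<dots> = 1 / real d" using assms by (simp add: powr_minus_divide)
  finally have "exploration_rate d 0 = 1 / (2 * real d)"
    by (simp add: exploration_rate_def)
  then show ?thesis using exploration_rate_antimono[OF assms, of 0 k] by simp
qed

lemma exploration_rate_tendsto_0: "exploration_rate d \<longlonglongrightarrow> 0"
proof -
  have "(\<lambda>k. 1 / 2 * (D + real k) powr (- 1 / 2)) \<longlonglongrightarrow> 0" for D :: real
    by real_asymp
  then show ?thesis unfolding exploration_rate_def[abs_def] .
qed

text \<open>The bracket is the lower bound on the counts provided by tracking. It grows like half
  the square root of \<open>n\<close>, so the terms decay faster than any power of
  \<open>n\<close>.\<close>

lemma summable_exploration:
  assumes "0 < \<delta>"
  shows "summable (\<lambda>n. exp (- \<delta> * (real n * exploration_rate d n - real d)))"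
proof (rule summable_comparison_test_bigo)
  show "summable (\<lambda>n. norm (1 / real n ^ 2))"
    using inverse_power_summable[of 2, where 'a=real] by (simp add: divide_inverse)
  have "(\<lambda>n. exp (- \<delta> * (real n * (1 / 2 * (D + real n) powr (- 1 / 2)) - c))) \<in> O(\<lambda>n. 1 / real n ^ 2)"
    for c D :: real
    using assms by real_asymp
  then show "(\<lambda>n. exp (- \<delta> * (real n * exploration_rate d n - real d))) \<in> O(\<lambda>n. 1 / real n ^ 2)"
    unfolding exploration_rate_def .
qed

context proposed_policy
begin

section \<open>Tracking of the target weights by the control counts\<close>

definition control_weights :: "nat \<Rightarrow> 'w \<Rightarrow> real ^ 'u" where
  "control_weights k \<omega> = qproj (exploration_rate CARD('u) k) (plug_in k \<omega>)"

lemma rec_mem: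
  assumes "CARD('u) \<le> n" "\<omega> \<in> space P"
  shows "rec n \<omega> \<in> {1..M}"
  using rec[OF assms] by (simp add: is_arg_min_def)

lemma plug_in_all_Theta:
  assumes "\<omega> \<in> space P"
  shows "plug_in k \<omega> \<in> all_Theta"
proof (cases "k < CARD('u)")
  case True
  then show ?thesis using plug_in_initial[OF True assms] \<theta>\<^sub>0 by simp
next
  case False
  then show ?thesis
    using plug_in_mem[of k \<omega>] rec_mem[of k \<omega>] assms by (auto simp: all_Theta_def)
qed

lemma control_weights_projection:
  assumes "\<omega> \<in> space P"
  shows "is_simplex_projection (exploration_rate CARD('u) k) (qstar (plug_in k \<omega>)) (control_weights k \<omega>)"
  unfolding control_weights_def
proof (rule qproj)
  have "1 / (2 * real CARD('u)) \<le> 1 / real CARD('u)" by (simp add: field_simps)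
  then show "exploration_rate CARD('u) k \<le> 1 / real CARD('u)"
    using exploration_rate_le[of "CARD('u)" k] by simp
qed (simp_all add: exploration_rate_pos plug_in_all_Theta assms)

lemma control_weights_props:
  assumes "\<omega> \<in> space P"
  shows "(\<Sum>u\<in>UNIV. control_weights k \<omega> $ u) = 1"
    and "exploration_rate CARD('u) k \<le> control_weights k \<omega> $ u"
    and "0 < control_weights k \<omega> $ u"
proof -
  show "(\<Sum>u\<in>UNIV. control_weights k \<omega> $ u) = 1"
    and *: "exploration_rate CARD('u) k \<le> control_weights k \<omega> $ u"
    using control_weights_projection[OF assms, of k]
    by (auto simp: is_simplex_projection_def is_arg_min_def prob_simplex_def)
  show "0 < control_weights k \<omega> $ u"
    using exploration_rate_pos[of "CARD('u)" k] * by simp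
qed

lemma num_used_initial:
  assumes "\<omega> \<in> space P"
  shows "num_used u CARD('u) \<omega> = 1"
proof -
  have bij: "bij_betw (\<lambda>k. U k \<omega>) {1..CARD('u)} UNIV" by (rule initial_controls[OF assms])
  then have "u \<in> (\<lambda>k. U k \<omega>) ` {1..CARD('u)}" unfolding bij_betw_def by blast
  then obtain k where k: "k \<in> {1..CARD('u)}" "U k \<omega> = u" by blast
  have inj: "inj_on (\<lambda>k. U k \<omega>) {1..CARD('u)}" using bij by (rule bij_betw_imp_inj_on)
  have "j = k" if "j \<in> {1..CARD('u)}" "U j \<omega> = u" for j
    by (rule inj_onD[OF inj _ that(1) k(1)]) (simp only: that(2) k(2))
  with k have "{k\<in>{1..CARD('u)}. U k \<omega> = u} = {k}" by blast
  then show ?thesis by (simp add: num_used_def)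
qed

lemma num_used_pos: "\<omega> \<in> space P \<Longrightarrow> CARD('u) \<le> n \<Longrightarrow> 0 < num_used u n \<omega>"
  using num_used_initial[of \<omega> u] num_used_mono[of "CARD('u)" n u \<omega>] by simp

text \<open>The negative of the quantity that the control law maximizes.\<close>

definition deviation :: "'u \<Rightarrow> nat \<Rightarrow> 'w \<Rightarrow> real" where
  "deviation u n \<omega> = real (num_used u n \<omega>) - (\<Sum>k\<in>{1..n}. control_weights k \<omega> $ u)"

lemma sum_deviation:
  assumes "\<omega> \<in> space P"
  shows "(\<Sum>u\<in>UNIV. deviation u n \<omega>) = 0"
proof -
  have "(\<Sum>u\<in>UNIV. \<Sum>k\<in>{1..n}. control_weights k \<omega> $ u) = (\<Sum>k\<in>{1..n}. \<Sum>u\<in>UNIV. control_weights k \<omega> $ u)"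
    by (rule sum.swap)
  also have "\<dots> = real n" by (simp add: control_weights_props[OF assms])
  finally show ?thesis
    using sum_num_used[of n \<omega>] by (simp add: deviation_def sum_subtractf flip: of_nat_sum)
qed

text \<open>A control is only selected while its deviation is minimal, hence nonpositive.\<close>

lemma deviation_le_1:
  assumes \<omega>: "\<omega> \<in> space P" and "CARD('u) \<le> n"
  shows "deviation u n \<omega> \<le> 1"
  using assms(2)
proof (induction n rule: dec_induct)
  case base
  then show ?case
    using control_weights_props(3)[OF \<omega>] num_used_initial[OF \<omega>, of u]
    by (simp add: deviation_def sum_nonneg less_imp_le)
next
  case (step n)
  have S: "deviation u (Suc n) \<omega> = deviation u n \<omega> + (if U (Suc n) \<omega> = u then 1 else 0) - control_weights (Suc n) \<omega> $ u"
    by (simp add: deviation_def num_used_Suc)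
  show ?case
  proof (cases "U (Suc n) \<omega> = u")
    case True
    have "deviation u n \<omega> \<le> deviation v n \<omega>" for v
      using control_law[OF step(1) \<omega>] True
      by (auto simp: is_arg_max_def deviation_def control_weights_def not_less algebra_simps)
    then have "0 < deviation u n \<omega> \<Longrightarrow> 0 < (\<Sum>v\<in>UNIV. deviation v n \<omega>)"
      by (intro sum_pos) (auto intro: less_le_trans)
    then have "deviation u n \<omega> \<le> 0"
      using sum_deviation[OF \<omega>, of n] by force
    then show ?thesis using S control_weights_props(3)[OF \<omega>, of "Suc n" u] by (simp add: True)
  next
    case False
    then show ?thesis using S control_weights_props(3)[OF \<omega>, of "Suc n" u] step.IH by simp
  qed
qed

text \<open>The deviations sum to zero, and those of the other controls are at most 1 each.\<close>

lemma deviation_ge: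
  assumes \<omega>: "\<omega> \<in> space P" and n: "CARD('u) \<le> n"
  shows "- real CARD('u) \<le> deviation u n \<omega>"
proof -
  have "0 = deviation u n \<omega> + (\<Sum>v\<in>UNIV - {u}. deviation v n \<omega>)"
    using sum_deviation[OF \<omega>, of n] sum.remove[of UNIV u "\<lambda>v. deviation v n \<omega>"] by simp
  also have "(\<Sum>v\<in>UNIV - {u}. deviation v n \<omega>) \<le> (\<Sum>v\<in>UNIV - {u}. 1)"
    by (intro sum_mono deviation_le_1 \<omega> n)
  also have "\<dots> \<le> real CARD('u)" by (simp add: card_Diff_singleton)
  finally show ?thesis by simp
qed

text \<open>The exploration rate is nonincreasing, so the first \<open>n\<close> weights are all at
  least its value at \<open>n\<close>; tracking loses at most the number of controls.\<close>

lemma num_used_lower_bound: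
  assumes \<omega>: "\<omega> \<in> space P"
  shows "real n * exploration_rate CARD('u) n - real CARD('u) \<le> real (num_used u n \<omega>)"
proof (cases "CARD('u) \<le> n")
  case True
  have "real n * exploration_rate CARD('u) n = (\<Sum>k\<in>{1..n}. exploration_rate CARD('u) n)" by simp
  also have "\<dots> \<le> (\<Sum>k\<in>{1..n}. control_weights k \<omega> $ u)"
    by (intro sum_mono order_trans[OF exploration_rate_antimono control_weights_props(2)[OF \<omega>]]) auto
  finally show ?thesis using deviation_ge[OF \<omega> True, of u] by (simp add: deviation_def)
next
  case False
  \<comment> \<open>During the initial round the left-hand side is not positive, so the bound holds
    at all times.\<close>
  have "real n * exploration_rate CARD('u) n \<le> real CARD('u) * (1 / (2 * real CARD('u)))"
    using False exploration_rate_le[of "CARD('u)" n] exploration_rate_pos[of "CARD('u)" n]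
    by (intro mult_mono) auto
  also have "\<dots> \<le> 1" by simp
  also have "1 \<le> real CARD('u)" using zero_less_card_finite[where 'a='u] by linarith
  finally show ?thesis by simp
qed

section \<open>Law of large numbers for the sufficient statistics\<close>

lemma AE_stat_sum_point:
  assumes \<theta>: "\<theta> \<in> Omega" and t: "t \<in> natural_set u" and \<eta>: "0 < \<eta>"
  shows "AE \<omega> in P. \<forall>\<^sub>F n in sequentially.
    (stat_sum u n \<omega> - deriv (A u) (\<theta> $ u) * real (num_used u n \<omega>)) * (t - \<theta> $ u)
      \<le> \<eta> * real (num_used u n \<omega>) * \<bar>t - \<theta> $ u\<bar>"
proof (cases "t = \<theta> $ u")
  case False
  have \<theta>u: "\<theta> $ u \<in> natural_set u" using \<theta> by (simp add: Omega_def)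
  \<comment> \<open>The ratio bound is applied at a point \<open>r\<close> so near to
    \<open>\<theta> $ u\<close> that the divergence is negligible. The claim is linear along the
    segment, so it scales back from \<open>r\<close> to \<open>t\<close>.\<close>
  obtain e where e: "0 < e" "\<And>r. \<bar>r - \<theta> $ u\<bar> < e \<Longrightarrow> \<bar>bregman u (\<theta> $ u) r\<bar> \<le> \<eta> / 2 * \<bar>r - \<theta> $ u\<bar>"
    using bregman_small[OF \<theta>u, of "\<eta> / 2"] \<eta> by auto
  define l where "l = min 1 (e / (2 * \<bar>t - \<theta> $ u\<bar>))"
  have l: "0 < l" "l \<le> 1" "l * \<bar>t - \<theta> $ u\<bar> < e"
    using e(1) False by (auto simp: l_def min_def field_simps)
  define r where "r = \<theta> $ u + l * (t - \<theta> $ u)"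
  have r: "r \<in> natural_set u" unfolding r_def using natural_set_segment[OF \<theta>u t] l by simp
  have rt: "\<bar>r - \<theta> $ u\<bar> = l * \<bar>t - \<theta> $ u\<bar>" using l by (simp add: r_def abs_mult)
  have br: "bregman u (\<theta> $ u) r \<le> \<eta> / 2 * (l * \<bar>t - \<theta> $ u\<bar>)"
    using e(2)[of r] l unfolding rt by linarith
  \<comment> \<open>The term \<open>2 * \<delta>\<close> uses half of the allowed slope
    \<open>\<eta>\<close>, the divergence at \<open>r\<close> the other half.\<close>
  define \<delta> where "\<delta> = \<eta> / 4 * (l * \<bar>t - \<theta> $ u\<bar>)"
  have \<delta>: "0 < \<delta>" using \<eta> l False by (simp add: \<delta>_def)
  have "AE \<omega> in P. \<forall>\<^sub>F n in sequentially.
    (r - \<theta> $ u) * stat_sum u n \<omega> - real (num_used u n \<omega>) * (A u r - A u (\<theta> $ u)) \<le> 2 * \<delta> * real (num_used u n \<omega>)"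
    by (rule AE_log_ratio_bound[OF \<theta> r \<delta> num_used_lower_bound summable_exploration[OF \<delta>]])
  then show ?thesis
  proof eventually_elim
    case (elim \<omega>)
    then show ?case
    proof eventually_elim
      case (elim n)
      let ?S = "stat_sum u n \<omega>" and ?N = "real (num_used u n \<omega>)" and ?k = "deriv (A u) (\<theta> $ u)"
      have *: "A u r - A u (\<theta> $ u) = bregman u (\<theta> $ u) r + ?k * (r - \<theta> $ u)" by (simp add: bregman_def)
      then have "(r - \<theta> $ u) * (?S - ?k * ?N) \<le> 2 * \<delta> * ?N + ?N * bregman u (\<theta> $ u) r"
        using elim unfolding * by (simp add: algebra_simps)
      also have "\<dots> \<le> 2 * \<delta> * ?N + ?N * (\<eta> / 2 * (l * \<bar>t - \<theta> $ u\<bar>))"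
        using br by (intro add_left_mono mult_left_mono) auto
      also have "\<dots> = l * (\<eta> * ?N * \<bar>t - \<theta> $ u\<bar>)" by (simp add: \<delta>_def field_simps)
      also have "(r - \<theta> $ u) * (?S - ?k * ?N) = l * ((?S - ?k * ?N) * (t - \<theta> $ u))"
        by (simp add: r_def)
      finally show ?case using l(1) by (simp only: mult_le_cancel_left_pos)
    qed
  qed
qed simp

text \<open>One natural parameter on each side of \<open>\<theta> $ u\<close> suffices, as both sides scale with \<open>\<bar>t - \<theta> $ u\<bar>\<close>.\<close>

lemma AE_stat_sum_uniform:
  assumes \<theta>: "\<theta> \<in> Omega" and \<eta>: "0 < \<eta>"
  shows "AE \<omega> in P. \<forall>\<^sub>F n in sequentially. \<forall>t\<in>natural_set u.
    (stat_sum u n \<omega> - deriv (A u) (\<theta> $ u) * real (num_used u n \<omega>)) * (t - \<theta> $ u)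
      \<le> \<eta> * real (num_used u n \<omega>) * \<bar>t - \<theta> $ u\<bar>"
proof -
  have side: "AE \<omega> in P. \<forall>\<^sub>F n in sequentially. \<forall>t\<in>natural_set u. 0 < \<sigma> * (t - \<theta> $ u) \<longrightarrow>
    (stat_sum u n \<omega> - deriv (A u) (\<theta> $ u) * real (num_used u n \<omega>)) * (t - \<theta> $ u)
      \<le> \<eta> * real (num_used u n \<omega>) * \<bar>t - \<theta> $ u\<bar>" if \<sigma>: "\<sigma> = 1 \<or> \<sigma> = - 1" for \<sigma> :: real
  proof (cases "\<exists>r\<in>natural_set u. 0 < \<sigma> * (r - \<theta> $ u)")
    case True
    then obtain r where r: "r \<in> natural_set u" "0 < \<sigma> * (r - \<theta> $ u)" by blast
    show ?thesis
      using AE_stat_sum_point[OF \<theta> r(1) \<eta>]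
    proof eventually_elim
      case (elim \<omega>)
      then show ?case
      proof eventually_elim
        case (elim n)
        let ?R = "stat_sum u n \<omega> - deriv (A u) (\<theta> $ u) * real (num_used u n \<omega>)"
        let ?b = "\<eta> * real (num_used u n \<omega>)"
        have ab: "0 < \<sigma> * (t - \<theta> $ u) \<Longrightarrow> \<bar>t - \<theta> $ u\<bar> = \<sigma> * (t - \<theta> $ u) \<and> t - \<theta> $ u = \<sigma> * \<bar>t - \<theta> $ u\<bar>" for t
          using \<sigma> by auto
        have "(?R * \<sigma>) * \<bar>r - \<theta> $ u\<bar> \<le> ?b * \<bar>r - \<theta> $ u\<bar>"
          using elim ab[OF r(2)] by (metis mult.assoc)
        then have *: "?R * \<sigma> \<le> ?b" using ab[OF r(2)] r(2) by (simp only: mult_le_cancel_right_pos)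
        show ?case
        proof (intro ballI impI)
          fix t assume "0 < \<sigma> * (t - \<theta> $ u)"
          then show "?R * (t - \<theta> $ u) \<le> ?b * \<bar>t - \<theta> $ u\<bar>"
            using mult_right_mono[OF *, of "\<bar>t - \<theta> $ u\<bar>"] ab[of t] by (metis abs_ge_zero mult.assoc)
        qed
      qed
    qed
  qed (auto intro!: AE_I2 always_eventually)
  show ?thesis
    using side[of 1, OF disjI1[OF refl]] side[of "- 1", OF disjI2[OF refl]]
  proof eventually_elim
    case (elim \<omega>)
    then show ?case
    proof eventually_elim
      case (elim n)
      show ?case
      proof
        fix t assume t: "t \<in> natural_set u"
        consider "t = \<theta> $ u" | "0 < 1 * (t - \<theta> $ u)" | "0 < - 1 * (t - \<theta> $ u)"
          using linorder_less_linear[of t "\<theta> $ u"] by auto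
        then show "(stat_sum u n \<omega> - deriv (A u) (\<theta> $ u) * real (num_used u n \<omega>)) * (t - \<theta> $ u)
            \<le> \<eta> * real (num_used u n \<omega>) * \<bar>t - \<theta> $ u\<bar>"
          using elim t by cases auto
      qed
    qed
  qed
qed

text \<open>Collects the almost sure properties of a sample path; the arguments for a regular
  \<open>\<omega>\<close> are deterministic. The law of large numbers is tested only in directions
  of natural parameters, which makes it one-sided at an endpoint.\<close>

definition regular :: "'w \<Rightarrow> bool" where
  "regular \<omega> \<longleftrightarrow> \<omega> \<in> space P \<and> (\<forall>k\<ge>1. 0 < h (U k \<omega>) (Y k \<omega>)) \<and>
     (\<forall>u \<eta>. 0 < \<eta> \<longrightarrow> (\<forall>\<^sub>F n in sequentially. \<forall>t\<in>natural_set u.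
        (stat_sum u n \<omega> - deriv (A u) (\<theta> $ u) * real (num_used u n \<omega>)) * (t - \<theta> $ u)
          \<le> \<eta> * real (num_used u n \<omega>) * \<bar>t - \<theta> $ u\<bar>))"

text \<open>Monotonicity in \<open>\<eta>\<close> reduces the uncountably many conditions to the
  reciprocals of positive integers.\<close>

lemma AE_regular:
  assumes \<theta>: "\<theta> \<in> Omega"
  shows "AE \<omega> in P. regular \<omega>"
proof -
  have "AE \<omega> in P. \<forall>u j. \<forall>\<^sub>F n in sequentially. \<forall>t\<in>natural_set u.
        (stat_sum u n \<omega> - deriv (A u) (\<theta> $ u) * real (num_used u n \<omega>)) * (t - \<theta> $ u)
          \<le> inverse (real (Suc j)) * real (num_used u n \<omega>) * \<bar>t - \<theta> $ u\<bar>"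
    using AE_stat_sum_uniform[OF \<theta>] by (simp add: AE_all_countable)
  with AE_h_pos[OF \<theta>] AE_space show ?thesis
  proof eventually_elim
    case (elim \<omega>)
    have "\<forall>\<^sub>F n in sequentially. \<forall>t\<in>natural_set u.
        (stat_sum u n \<omega> - deriv (A u) (\<theta> $ u) * real (num_used u n \<omega>)) * (t - \<theta> $ u)
          \<le> \<eta> * real (num_used u n \<omega>) * \<bar>t - \<theta> $ u\<bar>" if "0 < \<eta>" for u \<eta>
    proof -
      obtain j where j: "inverse (real (Suc j)) < \<eta>" using reals_Archimedean[OF \<open>0 < \<eta>\<close>] by auto
      show ?thesis
        using elim(3)[rule_format, of u j]
      proof eventually_elim
        case (elim n)
        have "inverse (real (Suc j)) * real (num_used u n \<omega>) * \<bar>t - \<theta> $ u\<bar>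
          \<le> \<eta> * real (num_used u n \<omega>) * \<bar>t - \<theta> $ u\<bar>" for t
          using j by (intro mult_right_mono) auto
        then show ?case using elim by (meson order_trans)
      qed
    qed
    then show ?case using elim by (simp add: regular_def)
  qed
qed

end

section \<open>Separation of the hypotheses and continuity of the optimal weights\<close>

context controlled_testing
begin

section \<open>The norm and distances to the hypotheses\<close>

lemma nrm_nonneg: "0 \<le> nrm v"
  and nrm_eq_0: "nrm v = 0 \<longleftrightarrow> v = 0"
  and nrm_scaleR: "nrm (c *\<^sub>R v) = \<bar>c\<bar> * nrm v"
  and nrm_triangle: "nrm (v + w) \<le> nrm v + nrm w"
  using nrm unfolding is_norm_def by auto

lemma nrm_minus_commute: "nrm (v - w) = nrm (w - v)"
  using nrm_scaleR[of "- 1" "v - w"] by simp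

lemma nrm_triangle_diff: "nrm (v - w) \<le> nrm (v - z) + nrm (z - w)"
  using nrm_triangle[of "v - z" "z - w"] by simp

lemma nrm_le_norm: "\<exists>K>0. \<forall>v. nrm v \<le> K * norm v"
proof -
  define K where "K = (\<Sum>i\<in>UNIV. nrm (axis i 1))"
  have sum: "nrm (\<Sum>i\<in>I. f i) \<le> (\<Sum>i\<in>I. nrm (f i))" for f :: "'b \<Rightarrow> real ^ 'b" and I
  proof (induction I rule: infinite_finite_induct)
    case (insert i I)
    then show ?case using nrm_triangle[of "f i" "\<Sum>i\<in>I. f i"] by simp
  qed (simp_all add: nrm_eq_0[THEN iffD2, OF refl])
  have "nrm v \<le> (K + 1) * norm v" for v
  proof -
    have "v = (\<Sum>i\<in>UNIV. v $ i *\<^sub>R axis i 1)"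
      using basis_expansion[of v] by (simp add: scalar_mult_eq_scaleR)
    then have "nrm v \<le> (\<Sum>i\<in>UNIV. nrm (v $ i *\<^sub>R axis i 1))" using sum by metis
    also have "\<dots> \<le> (\<Sum>i\<in>UNIV. norm v * nrm (axis i 1))"
      by (intro sum_mono) (simp add: nrm_scaleR nrm_nonneg mult_right_mono component_le_norm_cart)
    also have "\<dots> = K * norm v" by (simp add: K_def sum_distrib_left mult.commute)
    finally show ?thesis by (simp add: algebra_simps add_increasing)
  qed
  moreover have "0 \<le> K" unfolding K_def by (intro sum_nonneg nrm_nonneg)
  ultimately show ?thesis by (intro exI[of _ "K + 1"]) auto
qed

text \<open>By \<open>nrm_le_norm\<close> the norm is Lipschitz, so it attains a minimum on the
  compact Euclidean unit sphere, positive by definiteness.\<close>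

lemma norm_le_nrm: "\<exists>c>0. \<forall>v. c * norm v \<le> nrm v"
proof -
  obtain K where K: "0 < K" "\<And>v. nrm v \<le> K * norm v" using nrm_le_norm by blast
  have "\<bar>nrm v - nrm w\<bar> \<le> K * norm (v - w)" for v w
    using nrm_triangle_diff[of v 0 w] nrm_triangle_diff[of w 0 v] K(2)[of "v - w"]
    by (simp add: nrm_minus_commute[of v w])
  then have "K-lipschitz_on UNIV nrm"
    using K(1) by (intro lipschitz_onI) (simp_all add: dist_norm)
  then have "continuous_on (sphere 0 1) nrm"
    using lipschitz_on_continuous_on continuous_on_subset by blast
  moreover have "sphere (0 :: real ^ 'b) 1 \<noteq> {}" by simp
  ultimately obtain w where w: "w \<in> sphere 0 1" "\<And>v. v \<in> sphere 0 1 \<Longrightarrow> nrm w \<le> nrm v"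
    using continuous_attains_inf[of "sphere 0 1" nrm] by auto
  have "nrm w * norm v \<le> nrm v" for v
  proof (cases "v = 0")
    case False
    then have "nrm w \<le> nrm (inverse (norm v) *\<^sub>R v)" by (intro w(2)) simp
    then show ?thesis using False by (simp add: nrm_scaleR field_simps)
  qed (simp add: nrm_nonneg)
  moreover have "0 < nrm w" using w(1) nrm_eq_0[of w] nrm_nonneg[of w] by auto
  ultimately show ?thesis by blast
qed

lemma set_dist_le: "t \<in> S \<Longrightarrow> set_dist \<theta> S \<le> nrm (\<theta> - t)"
  unfolding set_dist_def by (intro cINF_lower bdd_belowI2[of _ 0]) (simp_all add: nrm_nonneg)

lemma le_set_dist: "S \<noteq> {} \<Longrightarrow> (\<And>t. t \<in> S \<Longrightarrow> r \<le> nrm (\<theta> - t)) \<Longrightarrow> r \<le> set_dist \<theta> S"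
  unfolding set_dist_def by (intro cINF_greatest)

lemma Theta_nonempty:
  assumes "m \<in> {1..M}" shows "Theta m \<noteq> {}"
proof -
  have "1 \<in> {1..x m}" using x_pos[OF assms] by simp
  then show ?thesis using \<Gamma>_nonempty[OF assms, of 1] by (auto simp: Theta_def)
qed

lemma Theta_disjoint:
  assumes "m \<in> {1..M}" "m' \<in> {1..M}" "m \<noteq> m'"
  shows "Theta m \<inter> Theta m' = {}"
  using \<Gamma>_separate[OF assms] unfolding Theta_def by blast

lemma all_Theta_Omega: "\<theta> \<in> all_Theta \<Longrightarrow> \<theta> \<in> Omega"
  using \<Gamma>_Omega unfolding all_Theta_def Theta_def by blast

lemma all_Theta_natural: "\<theta> \<in> all_Theta \<Longrightarrow> \<theta> $ u \<in> natural_set u"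
  using all_Theta_Omega by (simp add: Omega_def)

lemma Theta_all_Theta: "m \<in> {1..M} \<Longrightarrow> \<theta> \<in> Theta m \<Longrightarrow> \<theta> \<in> all_Theta"
  by (auto simp: all_Theta_def)

lemma true_hyp_eq:
  assumes "m \<in> {1..M}" "\<theta> \<in> Theta m"
  shows "true_hyp \<theta> = m"
  unfolding true_hyp_def
proof (rule the_equality)
  fix m' assume "m' \<in> {1..M} \<and> \<theta> \<in> Theta m'"
  then show "m' = m" using Theta_disjoint[OF assms(1), of m'] assms(2) by blast
qed (use assms in simp)

lemma pieces_separated:
  assumes m: "m \<in> {1..M}" and i: "i \<in> {1..x m}" and \<theta>: "\<theta> \<in> \<Gamma> m i"
  shows "\<exists>r>0. \<forall>m'\<in>{1..M}. \<forall>j\<in>{1..x m'}. (m', j) \<noteq> (m, i) \<longrightarrow> (\<forall>t\<in>\<Gamma> m' j. r \<le> nrm (\<theta> - t))"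
proof -
  define I where "I = (SIGMA m':{1..M}. {1..x m'}) - {(m, i)}"
  \<comment> \<open>A minimum of finitely many positive distances; the inserted 1 covers the case of
    no other piece.\<close>
  define r where "r = Min (insert 1 ((\<lambda>(m', j). set_dist \<theta> (\<Gamma> m' j)) ` I))"
  have fin: "finite I" by (simp add: I_def)
  have "0 < set_dist \<theta> (\<Gamma> m' j)" if "(m', j) \<in> I" for m' j
    using \<Gamma>_dist[OF m _ i _ _ \<theta>, of m' j] that by (auto simp: I_def)
  then have "0 < r" using fin by (auto simp: r_def)
  moreover have "r \<le> nrm (\<theta> - t)"
    if "m' \<in> {1..M}" "j \<in> {1..x m'}" "(m', j) \<noteq> (m, i)" "t \<in> \<Gamma> m' j" for m' j t
  proof -
    have "(m', j) \<in> I" using that by (simp add: I_def)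
    then have "r \<le> set_dist \<theta> (\<Gamma> m' j)"
      using fin unfolding r_def by (intro Min_le) force+
    then show ?thesis using set_dist_le[OF that(4), of \<theta>] by simp
  qed
  ultimately show ?thesis by blast
qed

text \<open>Since a piece is relatively open in its affine hull, a point near \<open>\<theta>\<close> which lies in the
  closure of the piece belongs to the piece. So the distance to the hypothesis is attained if it
  is zero.\<close>

lemma set_dist_pos_if_not_attained:
  assumes m: "m \<in> {1..M}" and \<theta>: "\<theta> \<in> Theta m"
  shows "\<exists>e>0. \<forall>z. norm (z - \<theta>) < e \<longrightarrow> z \<in> Theta m \<or> 0 < set_dist z (Theta m)"
proof -
  obtain i where i: "i \<in> {1..x m}" "\<theta> \<in> \<Gamma> m i" using \<theta> by (auto simp: Theta_def)
  obtain r where r: "0 < r" "\<And>j t. j \<in> {1..x m} \<Longrightarrow> j \<noteq> i \<Longrightarrow> t \<in> \<Gamma> m j \<Longrightarrow> r \<le> nrm (\<theta> - t)"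
    using pieces_separated[OF m i] m by blast
  obtain e where e: "0 < e" "ball \<theta> e \<inter> affine hull \<Gamma> m i \<subseteq> \<Gamma> m i"
    using \<Gamma>_open[OF m i(1)] i(2) unfolding openin_contains_ball by blast
  obtain K where K: "0 < K" "\<And>v. nrm v \<le> K * norm v" using nrm_le_norm by blast
  obtain c where c: "0 < c" "\<And>v. c * norm v \<le> nrm v" using norm_le_nrm by blast
  have "z \<in> Theta m \<or> 0 < set_dist z (Theta m)" if z: "norm (z - \<theta>) < min e (r / (2 * K))" for z
  proof (cases "z \<in> affine hull \<Gamma> m i")
    case True
    then have "z \<in> \<Gamma> m i" using e(2) z by (auto simp: dist_norm norm_minus_commute)
    then show ?thesis using i by (auto simp: Theta_def)
  next
    case False
    let ?a = "infdist z (affine hull \<Gamma> m i)"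
    have a: "0 < ?a"
      using False i(2) hull_inc[OF i(2), of affine] infdist_pos_not_in_closed[of "affine hull \<Gamma> m i" z] by auto
    have zr: "nrm (z - \<theta>) \<le> r / 2"
      using K(2)[of "z - \<theta>"] mult_left_mono[of "norm (z - \<theta>)" "r / (2 * K)" K] z K(1) by simp
    \<comment> \<open>The piece containing \<open>\<theta>\<close> lies in its affine hull, which is
      closed and misses \<open>z\<close>. The other pieces have distance at least \<open>r\<close>
      from \<open>\<theta>\<close>, of which \<open>z\<close> gives up at most half.\<close>
    have "min (c * ?a) (r / 2) \<le> set_dist z (Theta m)"
    proof (rule le_set_dist[OF Theta_nonempty[OF m]])
      fix t assume "t \<in> Theta m"
      then obtain j where j: "j \<in> {1..x m}" "t \<in> \<Gamma> m j" by (auto simp: Theta_def)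
      show "min (c * ?a) (r / 2) \<le> nrm (z - t)"
      proof (cases "j = i")
        case True
        then have "?a \<le> norm (z - t)" using infdist_le[of t "affine hull \<Gamma> m i" z] j hull_inc
          by (metis dist_norm)
        then have "c * ?a \<le> c * norm (z - t)" using c(1) by simp
        then show ?thesis using c(2)[of "z - t"] by linarith
      next
        case False
        then have "r \<le> nrm (\<theta> - t)" using r(2) j by blast
        then show ?thesis using nrm_triangle_diff[of \<theta> t z] zr nrm_minus_commute[of \<theta> z] by linarith
      qed
    qed
    then show ?thesis using a c(1) r(1) by (auto intro: less_le_trans[rotated])
  qed
  then show ?thesis using e(1) r(1) K(1) by (intro exI[of _ "min e (r / (2 * K))"]) auto
qed

text \<open>The other hypotheses have distance at least some \<open>r\<close> from
  \<open>\<theta>\<close>, so within \<open>r / 2\<close> of \<open>\<theta>\<close> its own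
  hypothesis is closer. This makes the recommendation correct once the maximum likelihood estimate
  is close.\<close>

lemma nearest_hypothesis:
  assumes m: "m \<in> {1..M}" and \<theta>: "\<theta> \<in> Theta m"
  shows "\<exists>e>0. \<forall>z. nrm (z - \<theta>) < e \<longrightarrow> (\<forall>m'\<in>{1..M}. m' \<noteq> m \<longrightarrow> set_dist z (Theta m) < set_dist z (Theta m'))"
proof -
  obtain i where i: "i \<in> {1..x m}" "\<theta> \<in> \<Gamma> m i" using \<theta> by (auto simp: Theta_def)
  obtain r where r: "0 < r" "\<And>m' j t. m' \<in> {1..M} \<Longrightarrow> j \<in> {1..x m'} \<Longrightarrow> m' \<noteq> m \<Longrightarrow> t \<in> \<Gamma> m' j \<Longrightarrow> r \<le> nrm (\<theta> - t)"
    using pieces_separated[OF m i] by blast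
  have "set_dist z (Theta m) < set_dist z (Theta m')"
    if z: "nrm (z - \<theta>) < r / 2" and m': "m' \<in> {1..M}" "m' \<noteq> m" for z m'
  proof -
    have "set_dist z (Theta m) \<le> nrm (z - \<theta>)" by (rule set_dist_le[OF \<theta>])
    also have "\<dots> < r / 2" by (rule z)
    also have "r / 2 \<le> set_dist z (Theta m')"
    proof (rule le_set_dist[OF Theta_nonempty[OF m'(1)]])
      fix t assume "t \<in> Theta m'"
      then have "r \<le> nrm (\<theta> - t)" using r(2) m' by (auto simp: Theta_def)
      then show "r / 2 \<le> nrm (z - t)"
        using nrm_triangle_diff[of \<theta> t z] z nrm_minus_commute[of \<theta> z] by linarith
    qed
    finally show ?thesis .
  qed
  then show ?thesis using r(1) by (intro exI[of _ "r / 2"]) auto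
qed

text \<open>Moving the base point changes the divergence by an affine function of \<open>t\<close>
  with small coefficients, whose linear part is controlled by \<open>dist_le_bregman\<close>. Hence
  the estimate is uniform in \<open>t\<close>, even over an unbounded set.\<close>

lemma bregman_perturb:
  assumes s: "s \<in> natural_set u" and \<eta>: "0 < \<eta>"
  shows "\<forall>\<^sub>F s' in nhds s. \<forall>t\<in>natural_set u. (1 - \<eta>) * bregman u s t - \<eta> \<le> bregman u s' t"
proof -
  obtain C where C: "0 < C" "\<And>t. t \<in> natural_set u \<Longrightarrow> \<bar>t - s\<bar> \<le> C * (1 + bregman u s t)"
    using dist_le_bregman[OF s] by auto
  define a where "a s' = A u s - A u s' - deriv (A u) s' * (s - s')" for s'
  define b where "b s' = deriv (A u) s - deriv (A u) s'" for s'
  have cA: "(A u \<longlongrightarrow> A u s) (nhds s)" "(deriv (A u) \<longlongrightarrow> deriv (A u) s) (nhds s)"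
    using isCont_A[OF s] isCont_deriv_A[OF s] unfolding isCont_def
    by (blast intro: tendsto_at_iff_tendsto_nhds[THEN iffD1])+
  have "(a \<longlongrightarrow> A u s - A u s - deriv (A u) s * (s - s)) (nhds s)"
    unfolding a_def by (intro tendsto_intros cA filterlim_ident)
  from tendstoD[OF this, of "\<eta> / 2"] have "\<forall>\<^sub>F s' in nhds s. \<bar>a s'\<bar> < \<eta> / 2"
    using \<eta> by (simp add: dist_real_def)
  moreover have "(b \<longlongrightarrow> deriv (A u) s - deriv (A u) s) (nhds s)"
    unfolding b_def by (intro tendsto_intros cA)
  from tendstoD[OF this, of "\<eta> / (2 * C)"] have "\<forall>\<^sub>F s' in nhds s. \<bar>b s'\<bar> < \<eta> / (2 * C)"
    using \<eta> C(1) by (simp add: dist_real_def)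
  ultimately show ?thesis
  proof eventually_elim
    case (elim s')
    show ?case
    proof
      fix t assume t: "t \<in> natural_set u"
      have B: "0 \<le> bregman u s t" by (rule bregman_nonneg[OF s t])
      have "\<bar>b s' * (t - s)\<bar> \<le> \<eta> / (2 * C) * (C * (1 + bregman u s t))"
        unfolding abs_mult using elim(2) C(2)[OF t] by (intro mult_mono) auto
      also have "\<dots> = \<eta> / 2 * (1 + bregman u s t)" using C(1) by simp
      finally have "\<bar>b s' * (t - s)\<bar> \<le> \<eta> / 2 + \<eta> / 2 * bregman u s t" by (simp add: algebra_simps)
      moreover have "bregman u s' t = bregman u s t + a s' + b s' * (t - s)"
        by (simp add: bregman_def a_def b_def algebra_simps)
      moreover have "0 \<le> \<eta> / 2 * bregman u s t" using B \<eta> by simp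
      moreover have "(1 - \<eta>) * bregman u s t = bregman u s t - \<eta> / 2 * bregman u s t - \<eta> / 2 * bregman u s t"
        by (simp add: algebra_simps)
      ultimately show "(1 - \<eta>) * bregman u s t - \<eta> \<le> bregman u s' t"
        using elim(1) by linarith
    qed
  qed
qed

end

section \<open>Continuity of the optimal weights\<close>

lemma compact_prob_simplex: "compact (prob_simplex :: (real ^ 'u::finite) set)"
proof (rule compact_eq_bounded_closed[THEN iffD2, OF conjI])
  have "norm q \<le> 1" if "q \<in> prob_simplex" for q :: "real ^ 'u"
  proof -
    have "norm q \<le> (\<Sum>u\<in>UNIV. \<bar>q $ u\<bar>)" by (rule norm_le_l1_cart)
    also have "\<dots> = 1" using that by (simp add: prob_simplex_def)
    finally show ?thesis .
  qed
  then show "bounded (prob_simplex :: (real ^ 'u) set)" by (auto simp: bounded_iff)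
  have "prob_simplex = (\<Inter>u. {q :: real ^ 'u. 0 \<le> q $ u}) \<inter> {q. (\<Sum>u\<in>UNIV. q $ u) = 1}"
    by (auto simp: prob_simplex_def)
  moreover have "closed \<dots>"
    by (intro closed_Int closed_INT ballI closed_Collect_le closed_Collect_eq continuous_intros)
  ultimately show "closed (prob_simplex :: (real ^ 'u) set)" by simp
qed

context controlled_testing
begin

lemma qstar_props:
  assumes "\<theta> \<in> all_Theta"
  shows "qstar \<theta> \<in> prob_simplex" "info \<theta> (qstar \<theta>) = Dstar \<theta>"
  using theI'[OF unique_maximizer[OF assms]] unfolding qstar_def by auto

lemma qstar_unique:
  assumes "\<theta> \<in> all_Theta" "q \<in> prob_simplex" "info \<theta> q = Dstar \<theta>"
  shows "q = qstar \<theta>"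
  using unique_maximizer[OF assms(1)] qstar_props[OF assms(1)] assms(2,3) by blast

lemma info_nonneg:
  assumes "\<theta> \<in> all_Theta" "q \<in> prob_simplex"
  shows "0 \<le> info \<theta> q"
  unfolding info_def KL_eq_bregman using assms bregman_nonneg all_Theta_natural
  by (intro INF_greatest) (auto simp: prob_simplex_def intro!: sum_nonneg mult_nonneg_nonneg)

lemma info_le_Dstar: "q \<in> prob_simplex \<Longrightarrow> info \<theta> q \<le> Dstar \<theta>"
  unfolding Dstar_def by (rule SUP_upper)

lemma Dstar_nonneg: "\<theta> \<in> all_Theta \<Longrightarrow> 0 \<le> Dstar \<theta>"
  using info_nonneg qstar_props by metis

lemma info_le:
  assumes "m \<in> {1..M}" "\<theta> \<in> Theta m" "t \<in> all_Theta - Theta m"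
  shows "info \<theta> q \<le> ereal (\<Sum>u\<in>UNIV. q $ u * bregman u (\<theta> $ u) (t $ u))"
  unfolding info_def KL_eq_bregman true_hyp_eq[OF assms(1,2)] using assms(3) by (rule INF_lower)

lemma le_info:
  assumes "m \<in> {1..M}" "\<theta> \<in> Theta m"
    and "\<And>t. t \<in> all_Theta - Theta m \<Longrightarrow> c \<le> ereal (\<Sum>u\<in>UNIV. q $ u * bregman u (\<theta> $ u) (t $ u))"
  shows "c \<le> info \<theta> q"
  unfolding info_def KL_eq_bregman true_hyp_eq[OF assms(1,2)] using assms(3) by (rule INF_greatest)

text \<open>The alternative \<open>t\<close> bounds the infimum in \<open>info\<close> from above;
  without alternatives that infimum is infinite.\<close>

lemma Dstar_finite:
  assumes m: "m \<in> {1..M}" and \<theta>: "\<theta> \<in> Theta m" and t: "t \<in> all_Theta - Theta m"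
  obtains D where "Dstar \<theta> = ereal D" "0 \<le> D"
    "\<And>t. t \<in> all_Theta - Theta m \<Longrightarrow> D \<le> (\<Sum>u\<in>UNIV. qstar \<theta> $ u * bregman u (\<theta> $ u) (t $ u))"
proof -
  have all: "\<theta> \<in> all_Theta" by (rule Theta_all_Theta[OF m \<theta>])
  note q = qstar_props[OF all]
  obtain D where D: "Dstar \<theta> = ereal D"
    using Dstar_nonneg[OF all] info_le[OF m \<theta> t, of "qstar \<theta>"] q(2) by (cases "Dstar \<theta>") auto
  show thesis
    using that[OF D] Dstar_nonneg[OF all] info_le[OF m \<theta>, of _ "qstar \<theta>"] q(2) D by simp
qed

text \<open>\<open>info\<close> is jointly upper semicontinuous as an infimum of continuous functions, and lower
  semicontinuous in the parameter by \<open>bregman_perturb\<close>.\<close>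

lemma qstar_cluster_point:
  assumes m: "m \<in> {1..M}" and \<theta>: "\<theta> \<in> Theta m"
    and s: "\<And>n. s n \<in> Theta m" and lim: "s \<longlonglongrightarrow> \<theta>"
    and q: "q \<in> prob_simplex" and limq: "(\<lambda>n. qstar (s n)) \<longlonglongrightarrow> q"
  shows "q = qstar \<theta>"
proof (rule qstar_unique[OF Theta_all_Theta[OF m \<theta>] q antisym[OF info_le_Dstar[OF q]]])
  have all: "\<theta> \<in> all_Theta" by (rule Theta_all_Theta[OF m \<theta>])
  show "Dstar \<theta> \<le> info \<theta> q"
  proof (rule le_info[OF m \<theta>])
    fix t assume t: "t \<in> all_Theta - Theta m"
    obtain D where D: "Dstar \<theta> = ereal D" "0 \<le> D"
      "\<And>t. t \<in> all_Theta - Theta m \<Longrightarrow> D \<le> (\<Sum>u\<in>UNIV. qstar \<theta> $ u * bregman u (\<theta> $ u) (t $ u))"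
      using Dstar_finite[OF m \<theta> t] by blast
    define L where "L = (\<Sum>u\<in>UNIV. q $ u * bregman u (\<theta> $ u) (t $ u))"
    have "(\<lambda>n. \<Sum>u\<in>UNIV. qstar (s n) $ u * bregman u (s n $ u) (t $ u)) \<longlonglongrightarrow> L"
      unfolding L_def bregman_def
      by (intro tendsto_sum tendsto_intros tendsto_vec_nth limq lim
          isCont_tendsto_compose[OF isCont_A[OF all_Theta_natural[OF all]]]
          isCont_tendsto_compose[OF isCont_deriv_A[OF all_Theta_natural[OF all]]])
    then have ge: "(1 - \<eta>) * D - \<eta> \<le> L" if \<eta>: "0 < \<eta>" "\<eta> \<le> 1" for \<eta>
    proof (rule tendsto_lowerbound)
      have "\<forall>\<^sub>F n in sequentially. \<forall>r\<in>natural_set u.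
          (1 - \<eta>) * bregman u (\<theta> $ u) r - \<eta> \<le> bregman u (s n $ u) r" for u
        using eventually_compose_filterlim[OF bregman_perturb[OF all_Theta_natural[OF all] \<eta>(1)]
            tendsto_vec_nth[OF lim]] .
      then have "\<forall>\<^sub>F n in sequentially. \<forall>u. \<forall>r\<in>natural_set u.
          (1 - \<eta>) * bregman u (\<theta> $ u) r - \<eta> \<le> bregman u (s n $ u) r"
        by (rule eventually_all_finite)
      then show "\<forall>\<^sub>F n in sequentially. (1 - \<eta>) * D - \<eta> \<le> (\<Sum>u\<in>UNIV. qstar (s n) $ u * bregman u (s n $ u) (t $ u))"
      proof eventually_elim
        case (elim n)
        have alln: "s n \<in> all_Theta" by (rule Theta_all_Theta[OF m s])
        let ?p = "qstar \<theta>"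
        have p: "0 \<le> ?p $ u" "(\<Sum>u\<in>UNIV. ?p $ u) = 1" for u
          using qstar_props(1)[OF all] by (auto simp: prob_simplex_def)
        \<comment> \<open>The fixed weights \<open>qstar \<theta>\<close> compete with the optimal
          weights at \<open>s n\<close>; at the nearby parameter they still guarantee almost
          \<open>D\<close>.\<close>
        have "ereal ((1 - \<eta>) * D - \<eta>) \<le> info (s n) ?p"
        proof (rule le_info[OF m s])
          fix r assume r: "r \<in> all_Theta - Theta m"
          have "(1 - \<eta>) * D - \<eta> \<le> (1 - \<eta>) * (\<Sum>u\<in>UNIV. ?p $ u * bregman u (\<theta> $ u) (r $ u)) - \<eta> * (\<Sum>u\<in>UNIV. ?p $ u)"
            using D(3)[OF r] \<eta> p(2) by (simp add: mult_left_mono)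
          also have "\<dots> = (\<Sum>u\<in>UNIV. ?p $ u * ((1 - \<eta>) * bregman u (\<theta> $ u) (r $ u) - \<eta>))"
            by (simp add: sum_distrib_left sum_subtractf[symmetric] algebra_simps)
          also have "\<dots> \<le> (\<Sum>u\<in>UNIV. ?p $ u * bregman u (s n $ u) (r $ u))"
            using elim p(1) all_Theta_natural r by (intro sum_mono mult_left_mono) auto
          finally show "ereal ((1 - \<eta>) * D - \<eta>) \<le> ereal (\<Sum>u\<in>UNIV. ?p $ u * bregman u (s n $ u) (r $ u))"
            by simp
        qed
        also have "\<dots> \<le> Dstar (s n)" by (rule info_le_Dstar[OF qstar_props(1)[OF all]])
        also have "\<dots> = info (s n) (qstar (s n))" by (rule qstar_props(2)[OF alln, symmetric])
        also have "\<dots> \<le> ereal (\<Sum>u\<in>UNIV. qstar (s n) $ u * bregman u (s n $ u) (t $ u))"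
          by (rule info_le[OF m s t])
        finally show ?case by simp
      qed
    qed simp
    have "D \<le> L + e" if "0 < e" for e
    proof -
      \<comment> \<open>Chosen so that the total loss \<open>\<eta> * (1 + D)\<close> is at most
        \<open>e\<close>.\<close>
      define \<eta> where "\<eta> = min 1 (e / (1 + D))"
      have \<eta>: "0 < \<eta>" "\<eta> \<le> 1" "\<eta> \<le> e / (1 + D)"
        using that D(2) by (auto simp: \<eta>_def)
      have "\<eta> * (1 + D) \<le> e" using \<eta>(3) D(2) by (simp add: pos_le_divide_eq)
      then show ?thesis using ge[OF \<eta>(1,2)] by (simp add: algebra_simps)
    qed
    then have "D \<le> L" by (rule field_le_epsilon)
    then show "Dstar \<theta> \<le> ereal (\<Sum>u\<in>UNIV. q $ u * bregman u (\<theta> $ u) (t $ u))"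
      by (simp add: D(1) L_def)
  qed
qed

text \<open>Otherwise, by compactness, some subsequence staying away from
  \<open>qstar \<theta>\<close> converges, and \<open>qstar_cluster_point\<close> contradicts
  this.\<close>

lemma qstar_tendsto:
  assumes m: "m \<in> {1..M}" and \<theta>: "\<theta> \<in> Theta m"
    and s: "\<And>n. s n \<in> Theta m" and lim: "s \<longlonglongrightarrow> \<theta>"
  shows "(\<lambda>n. qstar (s n)) \<longlonglongrightarrow> qstar \<theta>"
proof (rule ccontr)
  assume "\<not> (\<lambda>n. qstar (s n)) \<longlonglongrightarrow> qstar \<theta>"
  then obtain e where e: "0 < e" "\<not> (\<forall>\<^sub>F n in sequentially. dist (qstar (s n)) (qstar \<theta>) < e)"
    by (auto simp: tendsto_iff)
  obtain f :: "nat \<Rightarrow> nat" where f: "strict_mono f" "\<forall>n. \<not> dist (qstar (s (f n))) (qstar \<theta>) < e"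
    using not_eventually_sequentiallyD[OF e(2)] by blast
  have "qstar (s (f n)) \<in> prob_simplex" for n
    by (rule qstar_props(1)[OF Theta_all_Theta[OF m s]])
  then obtain q g where q: "q \<in> prob_simplex" "strict_mono g" "((\<lambda>n. qstar (s (f n))) \<circ> g) \<longlonglongrightarrow> q"
    using compact_prob_simplex unfolding compact_def by metis
  have "(\<lambda>n. s (f (g n))) \<longlonglongrightarrow> \<theta>"
    using LIMSEQ_subseq_LIMSEQ[OF LIMSEQ_subseq_LIMSEQ[OF lim f(1)] q(2)] by (simp add: o_def)
  then have "q = qstar \<theta>"
    using qstar_cluster_point[OF m \<theta>, of "\<lambda>n. s (f (g n))" q] s q(1,3) by (simp add: o_def)
  then have "\<forall>\<^sub>F n in sequentially. dist (qstar (s (f (g n)))) (qstar \<theta>) < e"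
    using q(3) e(1) by (auto simp: tendsto_iff o_def)
  then show False using f(2) by (auto simp: eventually_sequentially)
qed

end

section \<open>Consistency of the estimates\<close>

context controlled_testing
begin

text \<open>An interval that may be neither open nor closed is still compact near any of its points:
  on each side it either contains a segment or has no points.\<close>

lemma compact_natural_nhd:
  assumes s: "s \<in> natural_set u"
  shows "\<exists>e>0. compact (natural_set u \<inter> {s - e..s + e})"
proof -
  have up: "\<exists>e>0. \<forall>d. 0 < d \<longrightarrow> d \<le> e \<longrightarrow> s + d \<in> natural_set u \<or> (\<forall>t\<in>natural_set u. t \<le> s)"
  proof (cases "\<exists>t\<in>natural_set u. s < t")
    case True
    then obtain t where t: "t \<in> natural_set u" "s < t" by blast
    have "s + d \<in> natural_set u" if "0 < d" "d \<le> t - s" for d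
      using natural_set_segment[OF s t(1), of "d / (t - s)"] that t(2) by simp
    then show ?thesis using t(2) by (intro exI[of _ "t - s"]) auto
  qed (auto intro!: exI[of _ 1] simp: not_less)
  have down: "\<exists>e>0. \<forall>d. 0 < d \<longrightarrow> d \<le> e \<longrightarrow> s - d \<in> natural_set u \<or> (\<forall>t\<in>natural_set u. s \<le> t)"
  proof (cases "\<exists>t\<in>natural_set u. t < s")
    case True
    then obtain t where t: "t \<in> natural_set u" "t < s" by blast
    have "s - d \<in> natural_set u" if "0 < d" "d \<le> s - t" for d
    proof -
      have "s + d / (s - t) * (t - s) = s - d" using t(2) by (simp add: field_simps)
      then show ?thesis using natural_set_segment[OF s t(1), of "d / (s - t)"] that t(2) by simp
    qed
    then show ?thesis using t(2) by (intro exI[of _ "s - t"]) auto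
  qed (auto intro!: exI[of _ 1] simp: not_less)
  obtain e1 e2 where e: "0 < e1" "0 < e2"
    "\<And>d. 0 < d \<Longrightarrow> d \<le> e1 \<Longrightarrow> s + d \<in> natural_set u \<or> (\<forall>t\<in>natural_set u. t \<le> s)"
    "\<And>d. 0 < d \<Longrightarrow> d \<le> e2 \<Longrightarrow> s - d \<in> natural_set u \<or> (\<forall>t\<in>natural_set u. s \<le> t)"
    using up down by blast
  define d where "d = min e1 e2"
  have d: "0 < d" "d \<le> e1" "d \<le> e2" using e by (auto simp: d_def)
  \<comment> \<open>On a side without natural parameters the endpoint falls back to
    \<open>s\<close>.\<close>
  define hi where "hi = (if s + d \<in> natural_set u then s + d else s)"
  define lo where "lo = (if s - d \<in> natural_set u then s - d else s)"
  have hl: "lo \<in> natural_set u" "hi \<in> natural_set u" using s by (auto simp: lo_def hi_def)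
  have "lo \<le> hi" using d(1) by (simp add: lo_def hi_def)
  then have "{lo..hi} \<subseteq> natural_set u"
    using closed_segment_subset[OF hl convex_natural_set] by (simp add: closed_segment_eq_real_ivl)
  moreover have "natural_set u \<inter> {s - d..s + d} \<subseteq> {lo..hi}"
    using e(3)[OF d(1,2)] e(4)[OF d(1,3)] by (auto simp: lo_def hi_def intro!: antisym)
  moreover have "{lo..hi} \<subseteq> {s - d..s + d}" using d(1) by (auto simp: lo_def hi_def)
  ultimately have "natural_set u \<inter> {s - d..s + d} = {lo..hi}" by blast
  then show ?thesis using d(1) by (intro exI[of _ d]) simp
qed

end

context controlled_process
begin

text \<open>The log-likelihood of the observations under \<open>u\<close> without the
  \<open>h\<close> terms, which do not depend on the parameter.\<close>

definition log_lik :: "'u \<Rightarrow> nat \<Rightarrow> 'w \<Rightarrow> real \<Rightarrow> real" where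
  "log_lik u n \<omega> t = t * stat_sum u n \<omega> - real (num_used u n \<omega>) * A u t"

lemma likelihood_eq:
  "likelihood n \<omega> \<theta>' = (\<Prod>u\<in>UNIV. \<Prod>k\<in>{k\<in>{1..n}. U k \<omega> = u}. h u (Y k \<omega>)) * exp (\<Sum>u\<in>UNIV. log_lik u n \<omega> (\<theta>' $ u))"
proof -
  have "(\<Prod>k\<in>{k\<in>{1..n}. U k \<omega> = u}. dens \<theta>' u (Y k \<omega>))
      = (\<Prod>k\<in>{k\<in>{1..n}. U k \<omega> = u}. h u (Y k \<omega>)) * exp (log_lik u n \<omega> (\<theta>' $ u))" for u
  proof -
    have "log_lik u n \<omega> (\<theta>' $ u) = (\<Sum>k\<in>{k\<in>{1..n}. U k \<omega> = u}. \<theta>' $ u * T u (Y k \<omega>) - A u (\<theta>' $ u))"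
      by (simp add: log_lik_def stat_sum_def num_used_def sum_subtractf flip: sum_distrib_left)
    then show ?thesis by (simp only: dens_def prod.distrib) (simp add: exp_sum)
  qed
  then show ?thesis unfolding likelihood_def by (simp only: prod.distrib) (simp add: exp_sum)
qed

text \<open>Splits the difference into the count times the divergence and a noise term, which
  regularity controls.\<close>

lemma log_lik_diff:
  "log_lik u n \<omega> s - log_lik u n \<omega> t = real (num_used u n \<omega>) * bregman u s t
     - (stat_sum u n \<omega> - deriv (A u) s * real (num_used u n \<omega>)) * (t - s)"
  by (simp add: log_lik_def bregman_def algebra_simps)

end

lemma simplex_projection_dist:
  fixes q q' :: "real ^ 'u::finite"
  assumes proj: "is_simplex_projection e q q'" and q: "q \<in> prob_simplex"
    and e: "0 \<le> e" "real CARD('u) * e \<le> 1"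
  shows "\<bar>q' $ u - q $ u\<bar> \<le> real CARD('u) * e"
proof -
  let ?d = "real CARD('u)"
  have d: "1 \<le> ?d" using zero_less_card_finite[where 'a='u] by linarith
  have q0: "0 \<le> q $ v" and q1: "q $ v \<le> 1" and qs: "(\<Sum>v\<in>UNIV. q $ v) = 1" for v
  proof -
    show "0 \<le> q $ v" "(\<Sum>v\<in>UNIV. q $ v) = 1" for v using q by (auto simp: prob_simplex_def)
    then show "q $ v \<le> 1" using member_le_sum[of v UNIV "\<lambda>v. q $ v"] by simp
  qed
  \<comment> \<open>The competitor is the mixture of \<open>q\<close> with the uniform distribution
    of weight \<open>?d * e\<close>: it is feasible and moves no coordinate by more than that
    weight.\<close>
  define r :: "real ^ 'u" where "r = (\<chi> v. (1 - ?d * e) * q $ v + e)"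
  have r1: "(1 - ?d * e) * q $ v + e \<le> 1" for v
  proof -
    have "(1 - ?d * e) * q $ v \<le> (1 - ?d * e) * 1" using e q1 by (intro mult_left_mono) auto
    moreover have "1 * e \<le> ?d * e" using d e by (intro mult_right_mono)
    ultimately show ?thesis by simp
  qed
  have "(\<Sum>v\<in>UNIV. r $ v) = (1 - ?d * e) * (\<Sum>v\<in>UNIV. q $ v) + ?d * e"
    by (simp add: r_def sum.distrib sum_distrib_left)
  then have "r \<in> prob_simplex" "\<forall>v. r $ v \<in> {e..1}"
    using e q0 r1 qs by (auto simp: prob_simplex_def r_def)
  then have "infnorm (q' - q) \<le> infnorm (r - q)"
    using proj by (auto simp: is_simplex_projection_def is_arg_min_def not_less)
  also have "infnorm (r - q) \<le> ?d * e"
    unfolding infnorm_cart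
  proof (rule cSup_least)
    fix z assume "z \<in> {\<bar>(r - q) $ i\<bar> |i. i \<in> UNIV}"
    then obtain v where z: "z = \<bar>(r - q) $ v\<bar>" by auto
    have *: "(r - q) $ v = e - ?d * e * q $ v" by (simp add: r_def algebra_simps)
    have "0 \<le> ?d * e * q $ v" using e q0 by simp
    moreover have "?d * e * q $ v \<le> ?d * e * 1" using e q1 by (intro mult_left_mono) auto
    moreover have "1 * e \<le> ?d * e" using d e by (intro mult_right_mono)
    ultimately show "z \<le> ?d * e" unfolding z * using e(1) by (intro abs_leI; linarith)
  qed auto
  finally show ?thesis using component_le_infnorm_cart[of "q' - q" u] by simp
qed

context proposed_policy
begin

section \<open>Existence and consistency of the maximum likelihood estimate\<close>

lemma likelihood_regular:
  assumes "regular \<omega>"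
  shows "\<exists>c>0. \<forall>\<theta>'. likelihood n \<omega> \<theta>' = c * exp (\<Sum>u\<in>UNIV. log_lik u n \<omega> (\<theta>' $ u))"
proof (intro exI conjI allI)
  show "0 < (\<Prod>u\<in>UNIV. \<Prod>k\<in>{k\<in>{1..n}. U k \<omega> = u}. h u (Y k \<omega>))"
  proof (intro prod_pos ballI)
    fix u k assume "k \<in> {k\<in>{1..n}. U k \<omega> = u}"
    then show "0 < h u (Y k \<omega>)" using assms by (auto simp: regular_def)
  qed
qed (rule likelihood_eq)

lemma regular_space: "regular \<omega> \<Longrightarrow> \<omega> \<in> space P"
  by (simp add: regular_def)

lemma eventually_log_lik_bound:
  assumes \<omega>: "regular \<omega>" and \<eta>: "0 < \<eta>"
  shows "\<forall>\<^sub>F n in sequentially. \<forall>t\<in>natural_set u. real (num_used u n \<omega>) * (bregman u (\<theta> $ u) t - \<eta> * \<bar>t - \<theta> $ u\<bar>)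
    \<le> log_lik u n \<omega> (\<theta> $ u) - log_lik u n \<omega> t"
proof -
  have "\<forall>\<^sub>F n in sequentially. \<forall>t\<in>natural_set u.
        (stat_sum u n \<omega> - deriv (A u) (\<theta> $ u) * real (num_used u n \<omega>)) * (t - \<theta> $ u)
          \<le> \<eta> * real (num_used u n \<omega>) * \<bar>t - \<theta> $ u\<bar>"
    using \<omega> \<eta> by (simp add: regular_def)
  then show ?thesis
  proof eventually_elim
    case (elim n)
    show ?case
    proof
      fix t assume "t \<in> natural_set u"
      with elim show "real (num_used u n \<omega>) * (bregman u (\<theta> $ u) t - \<eta> * \<bar>t - \<theta> $ u\<bar>)
          \<le> log_lik u n \<omega> (\<theta> $ u) - log_lik u n \<omega> t"
        unfolding log_lik_diff right_diff_distrib[of "real (num_used u n \<omega>)"] by (simp add: mult_ac)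
    qed
  qed
qed

text \<open>Away from \<open>\<theta> $ u\<close> the divergence grows at least at rate
  \<open>c\<close>, while noise of slope \<open>c / 2\<close> consumes only half of it.\<close>

lemma eventually_log_lik_less:
  assumes \<theta>: "\<theta> \<in> all_Theta" and \<omega>: "regular \<omega>" and e: "0 < e"
  shows "\<forall>\<^sub>F n in sequentially. \<forall>t\<in>natural_set u. e \<le> \<bar>t - \<theta> $ u\<bar> \<longrightarrow> log_lik u n \<omega> t < log_lik u n \<omega> (\<theta> $ u)"
proof -
  obtain c where c: "0 < c" "\<And>t. t \<in> natural_set u \<Longrightarrow> e \<le> \<bar>t - \<theta> $ u\<bar> \<Longrightarrow> c * \<bar>t - \<theta> $ u\<bar> \<le> bregman u (\<theta> $ u) t"
    using bregman_linear_growth[OF all_Theta_natural[OF \<theta>] e] by blast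
  have "0 < c / 2" using c(1) by simp
  from eventually_log_lik_bound[OF \<omega> this, of u] eventually_ge_at_top[of "CARD('u)"]
  show ?thesis
  proof eventually_elim
    case (elim n)
    show ?case
    proof (intro ballI impI)
      fix t assume t: "t \<in> natural_set u" "e \<le> \<bar>t - \<theta> $ u\<bar>"
      have "0 < c / 2 * \<bar>t - \<theta> $ u\<bar>" using c(1) t(2) e by simp
      then have "0 < bregman u (\<theta> $ u) t - c / 2 * \<bar>t - \<theta> $ u\<bar>" using c(2)[OF t] by linarith
      moreover have "0 < real (num_used u n \<omega>)"
        using num_used_pos[OF regular_space[OF \<omega>] elim(2), of u] by simp
      ultimately have "0 < real (num_used u n \<omega>) * (bregman u (\<theta> $ u) t - c / 2 * \<bar>t - \<theta> $ u\<bar>)"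
        by (rule mult_pos_pos[rotated])
      then show "log_lik u n \<omega> t < log_lik u n \<omega> (\<theta> $ u)" using elim(1) t(1) by force
    qed
  qed
qed

text \<open>A maximum exists on a compact neighbourhood of \<open>\<theta> $ u\<close>; outside, the
  log-likelihood is below its value at \<open>\<theta> $ u\<close>.\<close>

lemma eventually_log_lik_max:
  assumes \<theta>: "\<theta> \<in> all_Theta" and \<omega>: "regular \<omega>"
  shows "\<forall>\<^sub>F n in sequentially. \<exists>t\<in>natural_set u. \<forall>s\<in>natural_set u. log_lik u n \<omega> s \<le> log_lik u n \<omega> t"
proof -
  have \<theta>u: "\<theta> $ u \<in> natural_set u" by (rule all_Theta_natural[OF \<theta>])
  obtain e where e: "0 < e" "compact (natural_set u \<inter> {\<theta> $ u - e..\<theta> $ u + e})" (is "compact ?K")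
    using compact_natural_nhd[OF \<theta>u] by blast
  from eventually_log_lik_less[OF \<theta> \<omega> e(1), of u] show ?thesis
  proof eventually_elim
    case (elim n)
    have "continuous_on ?K (log_lik u n \<omega>)"
      unfolding log_lik_def using isCont_A
      by (intro continuous_at_imp_continuous_on ballI continuous_intros) auto
    moreover have "\<theta> $ u \<in> ?K" using \<theta>u e(1) by simp
    ultimately obtain t where t: "t \<in> ?K" "\<And>s. s \<in> ?K \<Longrightarrow> log_lik u n \<omega> s \<le> log_lik u n \<omega> t"
      using continuous_attains_sup[OF e(2)] by blast
    have "log_lik u n \<omega> s \<le> log_lik u n \<omega> t" if s: "s \<in> natural_set u" for s
    proof (cases "s \<in> ?K")
      case False
      then have "log_lik u n \<omega> s < log_lik u n \<omega> (\<theta> $ u)"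
        using elim s by (auto simp: abs_if split: if_splits)
      then show ?thesis using t(2)[OF \<open>\<theta> $ u \<in> ?K\<close>] by linarith
    qed (rule t(2))
    then show ?case using t(1) by blast
  qed
qed

text \<open>The log-likelihood is a sum over coordinates and \<open>Omega\<close> is a product, so
  coordinatewise maximizers form a joint one; its existence activates the assumption on
  \<open>mle\<close>.\<close>

lemma eventually_mle:
  assumes \<theta>: "\<theta> \<in> all_Theta" and \<omega>: "regular \<omega>"
  shows "\<forall>\<^sub>F n in sequentially. is_arg_max (likelihood n \<omega>) (\<lambda>t. t \<in> Omega) (mle n \<omega>)"
proof -
  have "\<forall>\<^sub>F n in sequentially. \<forall>u. \<exists>t\<in>natural_set u. \<forall>s\<in>natural_set u. log_lik u n \<omega> s \<le> log_lik u n \<omega> t"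
    by (intro eventually_all_finite eventually_log_lik_max \<theta> \<omega>)
  then show ?thesis using eventually_ge_at_top[of "CARD('u)"]
  proof eventually_elim
    case (elim n)
    obtain f where f: "\<And>u. f u \<in> natural_set u" "\<And>u s. s \<in> natural_set u \<Longrightarrow> log_lik u n \<omega> s \<le> log_lik u n \<omega> (f u)"
      using elim(1) by metis
    obtain c where c: "0 < c" "\<And>\<theta>'. likelihood n \<omega> \<theta>' = c * exp (\<Sum>u\<in>UNIV. log_lik u n \<omega> (\<theta>' $ u))"
      using likelihood_regular[OF \<omega>, of n] by blast
    have "likelihood n \<omega> y \<le> likelihood n \<omega> (\<chi> u. f u)" if "y \<in> Omega" for y
      unfolding c(2) using c(1) f(2) that by (auto simp: Omega_def intro!: sum_mono)
    moreover have "(\<chi> u. f u) \<in> Omega" using f(1) by (simp add: Omega_def)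
    ultimately have "is_arg_max (likelihood n \<omega>) (\<lambda>t. t \<in> Omega) (\<chi> u. f u)"
      by (auto simp: is_arg_max_def not_less)
    then show ?case using mle[OF elim(2) regular_space[OF \<omega>]] by blast
  qed
qed

lemma mle_tendsto:
  assumes \<theta>: "\<theta> \<in> all_Theta" and \<omega>: "regular \<omega>"
  shows "(\<lambda>n. mle n \<omega>) \<longlonglongrightarrow> \<theta>"
proof (rule vec_tendstoI, rule tendstoI)
  fix u and e :: real assume e: "0 < e"
  from eventually_mle[OF \<theta> \<omega>] eventually_log_lik_less[OF \<theta> \<omega> e, of u]
  show "\<forall>\<^sub>F n in sequentially. dist (mle n \<omega> $ u) (\<theta> $ u) < e"
  proof eventually_elim
    case (elim n)
    show ?case
    proof (rule ccontr)
      assume far: "\<not> dist (mle n \<omega> $ u) (\<theta> $ u) < e"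
      have mO: "mle n \<omega> \<in> Omega" using elim(1) by (simp add: is_arg_max_def)
      \<comment> \<open>Replacing only the distant coordinate by the true one would strictly raise
        the likelihood.\<close>
      define y where "y = (\<chi> v. if v = u then \<theta> $ u else mle n \<omega> $ v)"
      have yO: "y \<in> Omega"
        using mO all_Theta_natural[OF \<theta>] by (simp add: Omega_def y_def)
      obtain c where c: "0 < c" "\<And>\<theta>'. likelihood n \<omega> \<theta>' = c * exp (\<Sum>u\<in>UNIV. log_lik u n \<omega> (\<theta>' $ u))"
        using likelihood_regular[OF \<omega>, of n] by blast
      have "log_lik u n \<omega> (mle n \<omega> $ u) < log_lik u n \<omega> (\<theta> $ u)"
        using elim(2) mO far by (simp add: Omega_def dist_real_def)
      then have "(\<Sum>v\<in>UNIV. log_lik v n \<omega> (mle n \<omega> $ v)) < (\<Sum>v\<in>UNIV. log_lik v n \<omega> (y $ v))"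
        by (intro sum_strict_mono_ex1) (auto simp: y_def)
      then have "likelihood n \<omega> (mle n \<omega>) < likelihood n \<omega> y"
        unfolding c(2) using c(1) by simp
      then show False using elim(1) yO by (auto simp: is_arg_max_def)
    qed
  qed
qed

lemma nrm_mle_tendsto:
  assumes \<theta>: "\<theta> \<in> all_Theta" and \<omega>: "regular \<omega>"
  shows "(\<lambda>n. nrm (mle n \<omega> - \<theta>)) \<longlonglongrightarrow> 0"
proof -
  obtain K where K: "0 < K" "\<And>v. nrm v \<le> K * norm v" using nrm_le_norm by blast
  have "(\<lambda>n. norm (mle n \<omega> - \<theta>)) \<longlonglongrightarrow> 0"
    using mle_tendsto[OF \<theta> \<omega>] by (simp add: LIM_zero_iff tendsto_norm_zero_iff)
  then have "(\<lambda>n. K * norm (mle n \<omega> - \<theta>)) \<longlonglongrightarrow> 0" by (rule tendsto_mult_right_zero)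
  then show ?thesis
    by (rule tendsto_sandwich[OF always_eventually always_eventually tendsto_const, rotated 2])
      (simp_all add: K(2) nrm_nonneg)
qed

lemma plug_in_consistent:
  assumes m: "m \<in> {1..M}" and \<theta>: "\<theta> \<in> Theta m" and \<omega>: "regular \<omega>"
  shows "\<forall>\<^sub>F n in sequentially. plug_in n \<omega> \<in> Theta m" and "(\<lambda>n. plug_in n \<omega>) \<longlonglongrightarrow> \<theta>"
proof -
  note all = Theta_all_Theta[OF m \<theta>]
  have sp: "\<omega> \<in> space P" by (rule regular_space[OF \<omega>])
  obtain e1 where e1: "0 < e1" "\<And>z. norm (z - \<theta>) < e1 \<Longrightarrow> z \<in> Theta m \<or> 0 < set_dist z (Theta m)"
    using set_dist_pos_if_not_attained[OF m \<theta>] by blast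
  obtain e2 where e2: "0 < e2"
    "\<And>z m'. nrm (z - \<theta>) < e2 \<Longrightarrow> m' \<in> {1..M} \<Longrightarrow> m' \<noteq> m \<Longrightarrow> set_dist z (Theta m) < set_dist z (Theta m')"
    using nearest_hypothesis[OF m \<theta>] by blast
  have "\<forall>\<^sub>F n in sequentially. norm (mle n \<omega> - \<theta>) < e1"
    using tendstoD[OF mle_tendsto[OF all \<omega>] e1(1)] by (simp add: dist_norm)
  moreover have "\<forall>\<^sub>F n in sequentially. nrm (mle n \<omega> - \<theta>) < e2"
    using order_tendstoD(2)[OF nrm_mle_tendsto[OF all \<omega>] e2(1)] .
  ultimately have close: "\<forall>\<^sub>F n in sequentially. plug_in n \<omega> \<in> Theta m \<and>
      nrm (plug_in n \<omega> - mle n \<omega>) \<le> \<rho> * nrm (mle n \<omega> - \<theta>)"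
    using eventually_ge_at_top[of "CARD('u)"]
  proof eventually_elim
    case (elim n)
    let ?z = "mle n \<omega>"
    have rm: "rec n \<omega> = m"
    proof (rule ccontr)
      assume "rec n \<omega> \<noteq> m"
      then have "set_dist ?z (Theta m) < set_dist ?z (Theta (rec n \<omega>))"
        using e2(2) elim(2) rec_mem[OF elim(3) sp] by blast
      then show False using rec[OF elim(3) sp] m by (auto simp: is_arg_min_def)
    qed
    \<comment> \<open>Since \<open>\<rho>\<close> exceeds 1, the exact and the approximate minimizer
      satisfy a common bound.\<close>
    have d\<rho>: "nrm (?z - \<theta>) \<le> \<rho> * nrm (?z - \<theta>)"
      using \<rho>_gt_1 nrm_nonneg[of "?z - \<theta>"] mult_right_mono[of 1 \<rho> "nrm (?z - \<theta>)"] by simp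
    have "nrm (plug_in n \<omega> - ?z) \<le> \<rho> * nrm (?z - \<theta>)"
    proof (cases "\<exists>t. is_arg_min (\<lambda>t. nrm (t - ?z)) (\<lambda>t. t \<in> Theta m) t")
      case True
      then have "is_arg_min (\<lambda>t. nrm (t - ?z)) (\<lambda>t. t \<in> Theta m) (plug_in n \<omega>)"
        using plug_in_minimizer[OF elim(3) sp] by (simp add: rm)
      then have "nrm (plug_in n \<omega> - ?z) \<le> nrm (\<theta> - ?z)"
        using \<theta> by (auto simp: is_arg_min_def not_less)
      then show ?thesis using d\<rho> by (simp add: nrm_minus_commute[of \<theta>])
    next
      case False
      \<comment> \<open>A point of the hypothesis would be its own minimizer. Hence the distance is
        positive near \<open>\<theta>\<close>, and the clause with factor \<open>\<rho>\<close>
        applies.\<close>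
      have "?z \<notin> Theta m"
      proof
        assume "?z \<in> Theta m"
        then have "is_arg_min (\<lambda>t. nrm (t - ?z)) (\<lambda>t. t \<in> Theta m) ?z"
          using nrm_nonneg nrm_eq_0[of 0] by (auto simp: is_arg_min_def not_less)
        then show False using False by blast
      qed
      then have "0 < set_dist ?z (Theta m)" using e1(2) elim(1) by blast
      then have "nrm (plug_in n \<omega> - ?z) \<le> \<rho> * set_dist ?z (Theta m)"
        using plug_in_no_minimizer[OF elim(3) sp] False by (simp add: rm)
      also have "\<dots> \<le> \<rho> * nrm (?z - \<theta>)"
        using \<rho>_gt_1 set_dist_le[OF \<theta>, of ?z] by (intro mult_left_mono) auto
      finally show ?thesis .
    qed
    then show ?case using plug_in_mem[OF elim(3) sp] rm by simp
  qed
  then show "\<forall>\<^sub>F n in sequentially. plug_in n \<omega> \<in> Theta m" by eventually_elim simp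
  obtain c where c: "0 < c" "\<And>v. c * norm v \<le> nrm v" using norm_le_nrm by blast
  have "(\<lambda>n. norm (plug_in n \<omega> - \<theta>)) \<longlonglongrightarrow> 0"
  proof (rule tendsto_sandwich[OF _ _ tendsto_const])
    show "\<forall>\<^sub>F n in sequentially. norm (plug_in n \<omega> - \<theta>) \<le> (\<rho> + 1) / c * nrm (mle n \<omega> - \<theta>)"
      using close
    proof eventually_elim
      case (elim n)
      then have "nrm (plug_in n \<omega> - \<theta>) \<le> (\<rho> + 1) * nrm (mle n \<omega> - \<theta>)"
        using nrm_triangle_diff[of "plug_in n \<omega>" \<theta> "mle n \<omega>"] by (simp add: algebra_simps)
      then have "c * norm (plug_in n \<omega> - \<theta>) \<le> (\<rho> + 1) * nrm (mle n \<omega> - \<theta>)"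
        using c(2) order_trans by blast
      then show ?case using c(1) by (simp add: field_simps)
    qed
    show "(\<lambda>n. (\<rho> + 1) / c * nrm (mle n \<omega> - \<theta>)) \<longlonglongrightarrow> 0"
      using nrm_mle_tendsto[OF all \<omega>] by (rule tendsto_mult_right_zero)
  qed simp
  then show "(\<lambda>n. plug_in n \<omega>) \<longlonglongrightarrow> \<theta>"
    by (simp add: LIM_zero_iff tendsto_norm_zero_iff)
qed

section \<open>Limits of the weights and of the control frequencies\<close>

lemma control_weights_tendsto:
  assumes m: "m \<in> {1..M}" and \<theta>: "\<theta> \<in> Theta m" and \<omega>: "regular \<omega>"
  shows "(\<lambda>n. control_weights n \<omega> $ u) \<longlonglongrightarrow> qstar \<theta> $ u"
proof -
  have sp: "\<omega> \<in> space P" by (rule regular_space[OF \<omega>])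
  \<comment> \<open>Finitely many plug-in estimates may lie outside the true hypothesis; replacing
    them by \<open>\<theta>\<close> makes \<open>qstar_tendsto\<close> applicable.\<close>
  define s where "s n = (if plug_in n \<omega> \<in> Theta m then plug_in n \<omega> else \<theta>)" for n
  have ev: "\<forall>\<^sub>F n in sequentially. plug_in n \<omega> = s n"
    using plug_in_consistent(1)[OF m \<theta> \<omega>] by eventually_elim (simp add: s_def)
  have "s \<longlonglongrightarrow> \<theta>"
    by (rule Lim_transform_eventually[OF plug_in_consistent(2)[OF m \<theta> \<omega>] ev])
  moreover have "s n \<in> Theta m" for n using \<theta> by (simp add: s_def)
  ultimately have q: "(\<lambda>n. qstar (s n)) \<longlonglongrightarrow> qstar \<theta>"
    by (rule qstar_tendsto[OF m \<theta>, rotated])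
  have "\<forall>\<^sub>F n in sequentially. qstar (s n) = qstar (plug_in n \<omega>)"
    using ev by eventually_elim (rule arg_cong[where f = qstar], rule sym)
  from Lim_transform_eventually[OF q this]
  have lim: "(\<lambda>n. qstar (plug_in n \<omega>) $ u) \<longlonglongrightarrow> qstar \<theta> $ u"
    by (rule tendsto_vec_nth)
  have bound: "\<bar>control_weights n \<omega> $ u - qstar (plug_in n \<omega>) $ u\<bar> \<le> real CARD('u) * exploration_rate CARD('u) n" for n
  proof (rule simplex_projection_dist[OF control_weights_projection[OF sp]])
    show "qstar (plug_in n \<omega>) \<in> prob_simplex" by (rule qstar_props(1)[OF plug_in_all_Theta[OF sp]])
    have "real CARD('u) * exploration_rate CARD('u) n \<le> real CARD('u) * (1 / (2 * real CARD('u)))"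
      by (intro mult_left_mono exploration_rate_le) simp_all
    then show "real CARD('u) * exploration_rate CARD('u) n \<le> 1" by simp
  qed (simp add: less_imp_le[OF exploration_rate_pos])
  have "(\<lambda>n. control_weights n \<omega> $ u - qstar (plug_in n \<omega>) $ u) \<longlonglongrightarrow> 0"
    using bound by (intro Lim_null_comparison[OF _ tendsto_mult_right_zero[OF exploration_rate_tendsto_0]])
      (auto intro!: always_eventually)
  from tendsto_add[OF this lim] show ?thesis by simp
qed

text \<open>Averaging of the convergent weights combined with tracking. A lower bound suffices later
  because divergences are nonnegative.\<close>

lemma eventually_num_used_ge:
  assumes m: "m \<in> {1..M}" and \<theta>: "\<theta> \<in> Theta m" and \<omega>: "regular \<omega>" and \<delta>: "0 < \<delta>"
  shows "\<forall>\<^sub>F n in sequentially. (1 - \<delta>) * qstar \<theta> $ u * real n \<le> real (num_used u n \<omega>)"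
proof (cases "qstar \<theta> $ u = 0")
  case False
  have sp: "\<omega> \<in> space P" by (rule regular_space[OF \<omega>])
  have q: "0 < qstar \<theta> $ u"
    using qstar_props(1)[OF Theta_all_Theta[OF m \<theta>]] False
    by (auto simp: prob_simplex_def order_less_le)
  \<comment> \<open>Half of \<open>\<delta>\<close> pays for the weights being only near their
    limit, the other half for the constants: the first \<open>k0\<close> weights and the tracking
    error.\<close>
  define a where "a = (1 - \<delta> / 2) * qstar \<theta> $ u"
  have "a < qstar \<theta> $ u" using q \<delta> by (simp add: a_def)
  then have "\<forall>\<^sub>F n in sequentially. a < control_weights n \<omega> $ u"
    by (rule order_tendstoD(1)[OF control_weights_tendsto[OF m \<theta> \<omega>]])
  then obtain k0 where k0: "\<And>k. k0 \<le> k \<Longrightarrow> a \<le> control_weights k \<omega> $ u"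
    unfolding eventually_sequentially by (meson less_imp_le)
  define b where "b = (\<Sum>k\<in>{1..k0}. control_weights k \<omega> $ u)"
  have sumge: "b + a * (real n - real k0) \<le> (\<Sum>k\<in>{1..n}. control_weights k \<omega> $ u)" if "k0 \<le> n" for n
    using that
  proof (induction n rule: dec_induct)
    case (step n)
    then show ?case using k0[of "Suc n"] by (simp add: algebra_simps)
  qed (simp add: b_def)
  have lin: "\<forall>\<^sub>F n in sequentially. a * real k0 + real CARD('u) - b \<le> \<delta> / 2 * qstar \<theta> $ u * real n"
    using q \<delta> by (intro eventually_compose_filterlim[OF eventually_ge_at_top[of "a * real k0 + real CARD('u) - b"]]
        filterlim_tendsto_pos_mult_at_top[OF tendsto_const _ filterlim_real_sequentially]) simp
  from lin eventually_ge_at_top[of k0] eventually_ge_at_top[of "CARD('u)"]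
  show ?thesis
  proof eventually_elim
    case (elim n)
    have "(1 - \<delta>) * qstar \<theta> $ u * real n = a * real n - \<delta> / 2 * qstar \<theta> $ u * real n"
      by (simp add: a_def algebra_simps)
    also have "\<dots> \<le> b + a * (real n - real k0) - real CARD('u)"
      using elim(1) by (simp add: algebra_simps)
    also have "\<dots> \<le> real (num_used u n \<omega>)"
      using sumge[OF elim(2)] deviation_ge[OF sp elim(3), of u] by (simp add: deviation_def)
    finally show ?case .
  qed
qed simp

end

section \<open>Growth of the test statistic\<close>

lemma log_poly_growth:
  fixes p c K \<eta> :: real
  assumes "0 < p" "0 < c" "0 < \<eta>"
  shows "\<forall>\<^sub>F n in sequentially. K + (ln (real n) + p * ln (1 + ln (real n))) + sqrt (c * (ln (real n) + p * ln (1 + ln (real n)))) \<le> \<eta> * real n"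
proof -
  have "(\<lambda>n. (K + (ln (real n) + p * ln (1 + ln (real n))) + sqrt (c * (ln (real n) + p * ln (1 + ln (real n))))) / real n) \<longlonglongrightarrow> 0"
    using assms by real_asymp
  from order_tendstoD(2)[OF this assms(3)] eventually_gt_at_top[of 0]
  show ?thesis by eventually_elim (simp add: field_simps)
qed

lemma eventually_threshold_v_le:
  assumes "0 < d" "0 < \<eta>"
  shows "\<forall>\<^sub>F n in sequentially. threshold_v d n \<le> \<eta> * real n"
proof -
  have "0 < real (d + 2)" "0 < 4 * real d" using assms by simp_all
  from log_poly_growth[OF this assms(2), of "threshold_const d"] eventually_ge_at_top[of 1]
  show ?thesis
  proof eventually_elim
    case (elim n)
    have "0 < 1 + ln (real n)" using elim(2) by (simp add: add_pos_nonneg)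
    then have "ln (real n * (1 + ln (real n)) ^ (d + 2)) = ln (real n) + real (d + 2) * ln (1 + ln (real n))"
      using elim(2) by (simp only: ln_mult_pos of_nat_0_less_iff zero_less_power ln_realpow)
    then show ?case using elim(1) unfolding threshold_v_def Let_def by simp
  qed
qed

text \<open>In terms of the variable \<open>\<bar>ln \<alpha>\<bar>\<close>, which tends to
  infinity, the constant and the square root are of lower order.\<close>

lemma hitting_time_tendsto:
  fixes c d K :: real
  assumes "0 < c" "0 \<le> d"
  shows "((\<lambda>\<alpha>. (K + (\<bar>ln \<alpha>\<bar> + sqrt (d * \<bar>ln \<alpha>\<bar>)) / c) / \<bar>ln \<alpha>\<bar>) \<longlongrightarrow> 1 / c) (at_right 0)"
proof -
  have lim: "((\<lambda>y. (K + (y + sqrt (d * y)) / c) / y) \<longlongrightarrow> 1 / c) at_top"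
  proof -
    have "((\<lambda>y. (K + (y + s * sqrt y) / c) / y) \<longlongrightarrow> inverse c) at_top" for s :: real
      using assms(1) by real_asymp
    from this[of "sqrt d"] show ?thesis by (simp add: real_sqrt_mult inverse_eq_divide)
  qed
  have "filterlim (\<lambda>\<alpha>::real. \<bar>ln \<alpha>\<bar>) at_top (at_right 0)" by real_asymp
  from filterlim_compose[OF lim this] show ?thesis .
qed

context proposed_policy
begin

text \<open>Uniformly over the alternatives, the log-likelihood at \<open>\<theta>\<close> leads by
  almost \<open>n\<close> times the divergence weighted with \<open>qstar \<theta>\<close>, which is
  at least \<open>Dstar \<theta>\<close>.\<close>

lemma eventually_Zmax_ge:
  assumes \<theta>: "\<theta> \<in> all_Theta" and \<omega>: "regular \<omega>" and c: "ereal c < Dstar \<theta>" "0 < c"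
  shows "\<forall>\<^sub>F n in sequentially. ereal (c * real n) \<le> Zmax n \<omega>"
proof -
  obtain m where m: "m \<in> {1..M}" and \<theta>m: "\<theta> \<in> Theta m" using \<theta> by (auto simp: all_Theta_def)
  have "\<forall>\<^sub>F n in sequentially. \<forall>j\<in>{1..M} - {m}. c * real n \<le> Zpair m j n \<omega>"
  proof (cases "all_Theta - Theta m = {}")
    case True
    \<comment> \<open>Hypotheses are nonempty and disjoint, so without alternative parameters there
      is no other hypothesis.\<close>
    have empty: "{1..M} - {m} = {}"
      using True Theta_nonempty Theta_disjoint[OF m] by (fastforce simp: all_Theta_def)
    show ?thesis unfolding empty by simp
  next
    case False
    then obtain t0 where t0: "t0 \<in> all_Theta - Theta m" by blast
    obtain D where D: "Dstar \<theta> = ereal D" "0 \<le> D"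
      "\<And>t. t \<in> all_Theta - Theta m \<Longrightarrow> D \<le> (\<Sum>u\<in>UNIV. qstar \<theta> $ u * bregman u (\<theta> $ u) (t $ u))"
      using Dstar_finite[OF m \<theta>m t0] by blast
    have cD: "c < D" using c D(1) by simp
    \<comment> \<open>One factor \<open>1 - e\<close> pays for the counts, the other together with
      \<open>- e\<close> for the noise; the choice leaves a rate of at least
      \<open>c\<close>.\<close>
    define e where "e = min (1 / 2) ((D - c) / (2 * D + 1))"
    have e: "0 < e" "e \<le> 1 / 2" "e \<le> (D - c) / (2 * D + 1)" using cD c(2) by (auto simp: e_def)
    have "e * (2 * D + 1) \<le> D - c" using e(3) cD c(2) by (simp add: pos_le_divide_eq)
    moreover have "0 \<le> e * e * D" using e(1) D(2) by simp
    ultimately have rate: "c \<le> (1 - e) * ((1 - e) * D) - e" by (simp add: algebra_simps)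
    have "\<exists>C>0. \<forall>t\<in>natural_set u. \<bar>t - \<theta> $ u\<bar> \<le> C * (1 + bregman u (\<theta> $ u) t)" for u
      by (rule dist_le_bregman[OF all_Theta_natural[OF \<theta>]])
    then obtain C where C: "\<And>u. 0 < C u"
      "\<And>u t. t \<in> natural_set u \<Longrightarrow> \<bar>t - \<theta> $ u\<bar> \<le> C u * (1 + bregman u (\<theta> $ u) t)" by metis
    \<comment> \<open>The noise slope \<open>e / C u\<close> turns the distance into at most
      \<open>e * (1 + bregman)\<close>.\<close>
    have "\<forall>\<^sub>F n in sequentially. \<forall>u. \<forall>t\<in>natural_set u.
        real (num_used u n \<omega>) * (bregman u (\<theta> $ u) t - e / C u * \<bar>t - \<theta> $ u\<bar>)
          \<le> log_lik u n \<omega> (\<theta> $ u) - log_lik u n \<omega> t"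
      using e(1) C(1) by (intro eventually_all_finite eventually_log_lik_bound[OF \<omega>]) simp
    moreover have "\<forall>\<^sub>F n in sequentially. \<forall>u. (1 - e) * qstar \<theta> $ u * real n \<le> real (num_used u n \<omega>)"
      by (intro eventually_all_finite eventually_num_used_ge[OF m \<theta>m \<omega> e(1)])
    ultimately show ?thesis using eventually_mle[OF \<theta> \<omega>]
    proof eventually_elim
      case (elim n)
      obtain b where b: "0 < b" "\<And>\<theta>'. likelihood n \<omega> \<theta>' = b * exp (\<Sum>u\<in>UNIV. log_lik u n \<omega> (\<theta>' $ u))"
        using likelihood_regular[OF \<omega>, of n] by blast
      have gap: "c * real n \<le> (\<Sum>u\<in>UNIV. log_lik u n \<omega> (\<theta> $ u)) - (\<Sum>u\<in>UNIV. log_lik u n \<omega> (t $ u))"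
        if t: "t \<in> all_Theta - Theta m" for t
      proof -
        let ?B = "\<lambda>u. bregman u (\<theta> $ u) (t $ u)" and ?N = "\<lambda>u. real (num_used u n \<omega>)"
        have tn: "t $ u \<in> natural_set u" for u using t all_Theta_natural by blast
        have B: "0 \<le> ?B u" for u by (rule bregman_nonneg[OF all_Theta_natural[OF \<theta>] tn])
        have N: "(\<Sum>u\<in>UNIV. ?N u) = real n" using sum_num_used[of n \<omega>] by (simp flip: of_nat_sum)
        have "c * real n \<le> ((1 - e) * ((1 - e) * D) - e) * real n"
          using rate by (intro mult_right_mono) simp_all
        also have "\<dots> = (1 - e) * ((1 - e) * real n * D) - e * real n" by (simp add: algebra_simps)
        also have "\<dots> \<le> (1 - e) * ((1 - e) * real n * (\<Sum>u\<in>UNIV. qstar \<theta> $ u * ?B u)) - e * real n"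
          using e(1,2) D(3)[OF t] by (intro diff_right_mono mult_left_mono) simp_all
        also have "(1 - e) * real n * (\<Sum>u\<in>UNIV. qstar \<theta> $ u * ?B u) = (\<Sum>u\<in>UNIV. ((1 - e) * qstar \<theta> $ u * real n) * ?B u)"
          by (simp add: sum_distrib_left mult_ac)
        also have "(1 - e) * \<dots> - e * real n \<le> (1 - e) * (\<Sum>u\<in>UNIV. ?N u * ?B u) - e * real n"
          using e(1,2) elim(2) B by (intro diff_right_mono mult_left_mono sum_mono mult_right_mono) simp_all
        \<comment> \<open>The counts total \<open>n\<close>, so the loss \<open>e * real n\<close>
          is distributed over the controls.\<close>
        also have "\<dots> = (\<Sum>u\<in>UNIV. ?N u * (?B u - e * (1 + ?B u)))"
          unfolding N[symmetric] sum_distrib_left sum_subtractf[symmetric]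
          by (intro sum.cong) (simp_all add: algebra_simps)
        also have "\<dots> \<le> (\<Sum>u\<in>UNIV. log_lik u n \<omega> (\<theta> $ u) - log_lik u n \<omega> (t $ u))"
        proof (rule sum_mono)
          fix u
          have "e / C u * \<bar>t $ u - \<theta> $ u\<bar> \<le> e / C u * (C u * (1 + ?B u))"
            using C(2)[OF tn, of u] e(1) C(1)[of u] by (intro mult_left_mono) simp_all
          also have "\<dots> = e * (1 + ?B u)" using C(1)[of u] by simp
          finally have "?N u * (?B u - e * (1 + ?B u)) \<le> ?N u * (?B u - e / C u * \<bar>t $ u - \<theta> $ u\<bar>)"
            by (intro mult_left_mono diff_left_mono) simp_all
          then show "?N u * (?B u - e * (1 + ?B u)) \<le> log_lik u n \<omega> (\<theta> $ u) - log_lik u n \<omega> (t $ u)"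
            using elim(1) tn by (meson order_trans)
        qed
        finally show ?thesis by (simp add: sum_subtractf)
      qed
      have gap': "likelihood n \<omega> t \<le> likelihood n \<omega> \<theta> * exp (- (c * real n))"
        if "t \<in> all_Theta - Theta m" for t
        unfolding b(2) using gap[OF that] b(1) by (simp add: mult.assoc flip: exp_add)
      have pos: "0 < likelihood n \<omega> t" for t unfolding b(2) using b(1) by simp
      show ?case
      proof
        fix j assume j: "j \<in> {1..M} - {m}"
        have alt: "t \<in> all_Theta - Theta m" if "t \<in> Theta j" for t
          using that j Theta_disjoint[OF m, of j] Theta_all_Theta[of j t] by blast
        have ne: "Theta j \<noteq> {}" using j Theta_nonempty by blast
        then obtain t where t: "t \<in> Theta j" by blast
        let ?sm = "SUP \<theta>'\<in>Theta m. likelihood n \<omega> \<theta>'" and ?sj = "SUP \<theta>'\<in>Theta j. likelihood n \<omega> \<theta>'"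
        have sj: "?sj \<le> likelihood n \<omega> \<theta> * exp (- (c * real n))"
          using gap' alt by (intro cSUP_least[OF ne]) blast
        have bdd: "bdd_above (likelihood n \<omega> ` Theta j)"
          using gap' alt by (intro bdd_aboveI2) blast
        have sj0: "0 < ?sj" using cSUP_upper[OF t bdd] pos[of t] by linarith
        \<comment> \<open>The real supremum needs an upper bound, which the existing maximum
          likelihood estimate provides.\<close>
        have "bdd_above (likelihood n \<omega> ` Theta m)"
        proof (rule bdd_aboveI2)
          fix s assume "s \<in> Theta m"
          then have "s \<in> Omega" using all_Theta_Omega Theta_all_Theta[OF m] by blast
          then show "likelihood n \<omega> s \<le> likelihood n \<omega> (mle n \<omega>)"
            using elim(3) by (auto simp: is_arg_max_def not_less)
        qed
        then have sm: "likelihood n \<omega> \<theta> \<le> ?sm" using \<theta>m by (intro cSUP_upper)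
        have "exp (c * real n) * ?sj \<le> exp (c * real n) * (likelihood n \<omega> \<theta> * exp (- (c * real n)))"
          using sj by (intro mult_left_mono) simp_all
        also have "\<dots> = likelihood n \<omega> \<theta>" by (simp add: exp_minus)
        also note sm
        finally have "exp (c * real n) \<le> ?sm / ?sj" using sj0 by (simp add: pos_le_divide_eq)
        then show "c * real n \<le> Zpair m j n \<omega>"
          unfolding Zpair_def by (subst ln_ge_iff) (auto intro: less_le_trans[OF exp_gt_zero])
      qed
    qed
  qed
  then show ?thesis
  proof eventually_elim
    case (elim n)
    have "ereal (c * real n) \<le> Zhyp m n \<omega>"
      unfolding Zhyp_def using elim by (intro INF_greatest) simp
    also have "\<dots> \<le> Zmax n \<omega>" unfolding Zmax_def using m by (rule SUP_upper)
    finally show ?case .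
  qed
qed

text \<open>The statistic outgrows the threshold by time \<open>threshold_w / c\<close> up to a
  constant that does not depend on \<open>\<alpha>\<close>.\<close>

lemma Limsup_stop_time_le:
  assumes \<theta>: "\<theta> \<in> all_Theta" and \<omega>: "regular \<omega>" and c: "0 < c" "ereal c < Dstar \<theta>"
  shows "Limsup (at_right 0) (\<lambda>\<alpha>. ereal_of_enat (stop_time \<alpha> \<omega>) / ereal \<bar>ln \<alpha>\<bar>) \<le> ereal (1 / c)"
proof -
  \<comment> \<open>The margin between \<open>c\<close> and \<open>c2\<close> pays for the sublinear
    part \<open>threshold_v\<close>.\<close>
  obtain c2 where c2: "ereal c < ereal c2" "ereal c2 < Dstar \<theta>" using ereal_dense2[OF c(2)] by blast
  then have cc: "c < c2" "0 < c2" using c(1) by auto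
  have "\<forall>\<^sub>F n in sequentially. threshold_v CARD('u) n \<le> (c2 - c) * real n"
    using cc by (intro eventually_threshold_v_le) simp_all
  with eventually_Zmax_ge[OF \<theta> \<omega> c2(2) cc(2)]
  have "\<forall>\<^sub>F n in sequentially. ereal (c2 * real n) \<le> Zmax n \<omega> \<and> threshold_v CARD('u) n \<le> (c2 - c) * real n"
    by eventually_elim simp
  then obtain n1 where n1: "\<And>n. n1 \<le> n \<Longrightarrow> ereal (c2 * real n) \<le> Zmax n \<omega>"
    "\<And>n. n1 \<le> n \<Longrightarrow> threshold_v CARD('u) n \<le> (c2 - c) * real n"
    unfolding eventually_sequentially by blast
  let ?w = "threshold_w CARD('u)"
  \<comment> \<open>One unit makes the time positive, the other covers rounding up.\<close>
  define K where "K = real n1 + 2"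
  have bound: "ereal_of_enat (stop_time \<alpha> \<omega>) \<le> ereal (K + ?w \<alpha> / c)" for \<alpha>
  proof -
    have w0: "0 \<le> ?w \<alpha>" by (simp add: threshold_w_def)
    define n where "n = n1 + 1 + nat \<lceil>?w \<alpha> / c\<rceil>"
    have n: "n1 \<le> n" "1 \<le> n" "?w \<alpha> / c \<le> real n" "real n \<le> K + ?w \<alpha> / c"
      using w0 c(1) unfolding n_def K_def by (simp_all, linarith+)
    have "threshold CARD('u) n \<alpha> \<le> (c2 - c) * real n + c * real n"
      using n1(2)[OF n(1)] n(3) c(1) by (simp add: threshold_def field_simps)
    then have "ereal (threshold CARD('u) n \<alpha>) \<le> Zmax n \<omega>"
      using n1(1)[OF n(1)] by (simp add: algebra_simps) (meson ereal_less_eq(3) order_trans)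
    then have "stop_time \<alpha> \<omega> \<le> enat n"
      unfolding stop_time_def using n(2) by (intro Inf_lower) simp
    then have "ereal_of_enat (stop_time \<alpha> \<omega>) \<le> ereal_of_enat (enat n)"
      by (simp only: ereal_of_enat_le_iff)
    also have "\<dots> \<le> ereal (K + ?w \<alpha> / c)" using n(4) by simp
    finally show ?thesis .
  qed
  have ev: "\<forall>\<^sub>F \<alpha> in at_right 0. ereal_of_enat (stop_time \<alpha> \<omega>) / ereal \<bar>ln \<alpha>\<bar>
      \<le> ereal ((K + ?w \<alpha> / c) / \<bar>ln \<alpha>\<bar>)"
    using eventually_at_right_real[of 0 1, OF zero_less_one]
  proof eventually_elim
    case (elim \<alpha>)
    then have "0 < \<bar>ln \<alpha>\<bar>" by auto
    then show ?case
      using ereal_divide_right_mono[OF bound[of \<alpha>], of "ereal \<bar>ln \<alpha>\<bar>"] by simp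
  qed
  have "((\<lambda>\<alpha>. (K + ?w \<alpha> / c) / \<bar>ln \<alpha>\<bar>) \<longlongrightarrow> 1 / c) (at_right 0)"
    unfolding threshold_w_def using c(1) by (intro hitting_time_tendsto) simp_all
  then have "Limsup (at_right 0) (\<lambda>\<alpha>. ereal ((K + ?w \<alpha> / c) / \<bar>ln \<alpha>\<bar>)) = ereal (1 / c)"
    by (intro lim_imp_Limsup) (simp_all add: trivial_limit_at_right_real)
  then show ?thesis using Limsup_mono[OF ev] by simp
qed

text \<open>Each real \<open>z\<close> above the bound is the reciprocal of a positive rate below
  \<open>Dstar \<theta>\<close>, also when the latter is infinite.\<close>

lemma Limsup_stop_time_le_Dstar:
  assumes \<theta>: "\<theta> \<in> all_Theta" and \<omega>: "regular \<omega>"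
  shows "Limsup (at_right 0) (\<lambda>\<alpha>. ereal_of_enat (stop_time \<alpha> \<omega>) / ereal \<bar>ln \<alpha>\<bar>) \<le> 1 / Dstar \<theta>"
proof (rule dense_ge)
  fix z assume z: "1 / Dstar \<theta> < z"
  show "Limsup (at_right 0) (\<lambda>\<alpha>. ereal_of_enat (stop_time \<alpha> \<omega>) / ereal \<bar>ln \<alpha>\<bar>) \<le> z"
  proof (cases z)
    case (real r)
    have D0: "0 \<le> Dstar \<theta>" by (rule Dstar_nonneg[OF \<theta>])
    \<comment> \<open>In the extended reals the reciprocal of 0 is infinite, and no \<open>z\<close>
      exceeds it.\<close>
    have "Dstar \<theta> \<noteq> 0" using z by (auto simp: divide_ereal_def)
    then consider "Dstar \<theta> = \<infinity>" | D where "Dstar \<theta> = ereal D" "0 < D"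
      using D0 by (cases "Dstar \<theta>") (auto simp: order_less_le)
    then have "0 < r \<and> ereal (1 / r) < Dstar \<theta>"
    proof cases
      case 2
      then have "1 / D < r" using z real by (simp add: one_ereal_def)
      moreover have "0 < 1 / D" using 2 by simp
      ultimately have "0 < r" by linarith
      with \<open>1 / D < r\<close> show ?thesis using 2 by (simp add: field_simps)
    qed (use z real in simp)
    then show ?thesis using Limsup_stop_time_le[OF \<theta> \<omega>, of "1 / r"] real by simp
  qed (use z Dstar_nonneg[OF \<theta>] in auto)
qed

end

theorem theorem2:
  fixes \<mu> :: "'y measure"
    and h T :: "'u::finite \<Rightarrow> 'y \<Rightarrow> real"
    and A :: "'u \<Rightarrow> real \<Rightarrow> real"
    and nrm :: "real ^ 'u \<Rightarrow> real"
    and M :: nat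
    and x :: "nat \<Rightarrow> nat"
    and \<Gamma> :: "nat \<Rightarrow> nat \<Rightarrow> (real ^ 'u) set"
    and P :: "'w measure"
    and U :: "nat \<Rightarrow> 'w \<Rightarrow> 'u"
    and Y :: "nat \<Rightarrow> 'w \<Rightarrow> 'y"
    and \<theta> \<theta>\<^sub>0 :: "real ^ 'u"
    and \<rho> :: real
    and qproj :: "real \<Rightarrow> real ^ 'u \<Rightarrow> real ^ 'u"
    and mle :: "nat \<Rightarrow> 'w \<Rightarrow> real ^ 'u"
    and rec :: "nat \<Rightarrow> 'w \<Rightarrow> nat"
    and plug_in :: "nat \<Rightarrow> 'w \<Rightarrow> real ^ 'u"
  assumes "proposed_policy \<mu> h T A nrm M x \<Gamma> P U Y \<theta> \<rho> qproj \<theta>\<^sub>0 mle rec plug_in"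
    and "\<theta> \<in> controlled_family.all_Theta M x \<Gamma>"
  shows "AE \<omega> in P.
           Limsup (at_right 0)
             (\<lambda>\<alpha>. ereal_of_enat (controlled_process.stop_time h T A M x \<Gamma> U Y \<alpha> \<omega>) / ereal \<bar>ln \<alpha>\<bar>)
           \<le> 1 / controlled_family.Dstar A M x \<Gamma> \<theta>"
proof -
  interpret proposed_policy \<mu> h T A nrm M x \<Gamma> P U Y \<theta> \<rho> qproj \<theta>\<^sub>0 mle rec plug_in
    by (rule assms(1))
  show ?thesis
    using AE_regular[OF all_Theta_Omega[OF assms(2)]]
    by eventually_elim (rule Limsup_stop_time_le_Dstar[OF assms(2)])
qed

end
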